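(* Let $d = \sum_{i=1}^{k+1} (d_i - 1)$ with $0 \le k < n$. Then every minimal weight codeword of $C_{\mathcal{X}}(d)$ (that is, every nonzero $f \in C_{\mathcal{X}}(d)$ with $|f| = \delta_{\mathcal{X}}(d)$) is $\mathcal{X}$-equivalent to a function of the form $$ \sigma \prod_{i=1}^{k+1} \left(1 - x_i^{d_i-1}\right), $$ with $\sigma \in \mathbb{F}_q^{*}$.
   Context: $\mathbb{F}_q$ is a finite field with $q$ elements, $n \ge 1$, and $K_1 \subset K_2 \subset \cdots \subset K_n \subset \mathbb{F}_q$ are subfields (inclusions need not be proper). Put $d_i = |K_i|$ and $\mathcal{X} = K_1 \times \cdots \times K_n \subset \mathbb{F}_q^n$. $C_{\mathcal{X}}$ is the $\mathbb{F}_q$-algebra of all functions $\mathcal{X} \to \mathbb{F}_q$. Each $f \in C_{\mathcal{X}}$ is induced by a unique polynomial $P \in \mathbb{F}_q[X_1,\ldots,X_n]$ whose degree in $X_i$ is less than $d_i$ for all $i$ (the reduced polynomial of $f$); the degree of $f$ is $\deg P$. $C_{\mathcal{X}}(d)$ is the $\mathbb{F}_q$-vector space of functions of degree at most $d$, together with the zero function. $|f|$ is the number of points of $\mathcal{X}$ where $f$ is nonzero, and $\delta_{\mathcal{X}}(d) = \min\{|f| : f \in C_{\mathcal{X}}(d),\ f \ne 0\}$. $x_i$ denotes the $i$-th coordinate function restricted to $\mathcal{X}$. $\mathrm{Aff}(n,\mathbb{F}_q)$ is the group of maps $\alpha \mapsto A\alpha + \beta$ of $\mathbb{F}_q^n$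 with $A \in GL(n,\mathbb{F}_q)$, $\beta \in \mathbb{F}_q^n$, and $\mathrm{Aff}(\mathcal{X})$ is the set of restrictions $\psi|_{\mathcal{X}} : \mathcal{X} \to \mathcal{X}$ of those $\psi \in \mathrm{Aff}(n,\mathbb{F}_q)$ with $\psi(\mathcal{X}) = \mathcal{X}$. Functions $f, g \in C_{\mathcal{X}}$ are $\mathcal{X}$-equivalent if $f = g \circ \varphi$ for some $\varphi \in \mathrm{Aff}(\mathcal{X})$. *)

theory Defs
  imports
    "Jordan_Normal_Form.Matrix"
    "HOL-Library.FuncSet"
    "HOL-Library.Poly_Mapping"
begin

(* All indices start at 0: the subfields are K 0, ..., K (n - 1), the coordinates of a point x
   are x $ 0, ..., x $ (n - 1), and the variables of a polynomial are numbered accordingly. *)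

definition is_subfield :: "'a::field set \<Rightarrow> bool" where
  "is_subfield S \<longleftrightarrow>
     0 \<in> S \<and> 1 \<in> S \<and>
     (\<forall>x\<in>S. \<forall>y\<in>S. x + y \<in> S) \<and> (\<forall>x\<in>S. - x \<in> S) \<and>
     (\<forall>x\<in>S. \<forall>y\<in>S. x * y \<in> S) \<and> (\<forall>x\<in>S. x \<noteq> 0 \<longrightarrow> inverse x \<in> S)"

definition cart :: "nat \<Rightarrow> (nat \<Rightarrow> 'a set) \<Rightarrow> 'a vec set" where
  "cart n K = {x \<in> carrier_vec n. \<forall>i<n. x $ i \<in> K i}"

(* A multivariate polynomial maps each monomial to its coefficient, and a monomial maps each
   variable to its exponent; both maps have finite support. *)

type_synonym 'a mpoly = "(nat \<Rightarrow>\<^sub>0 nat) \<Rightarrow>\<^sub>0 'a"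

definition mpoly_eval :: "'a::comm_semiring_1 mpoly \<Rightarrow> 'a vec \<Rightarrow> 'a" where
  "mpoly_eval P x =
     (\<Sum>m \<in> Poly_Mapping.keys P. Poly_Mapping.lookup P m *
        (\<Prod>i \<in> Poly_Mapping.keys m. (x $ i) ^ Poly_Mapping.lookup m i))"

(* The zero polynomial gets degree 0. *)
definition mpoly_degree :: "'a::zero mpoly \<Rightarrow> nat" where
  "mpoly_degree P =
     Max (insert 0 ((\<lambda>m. \<Sum>i \<in> Poly_Mapping.keys m. Poly_Mapping.lookup m i)
                      ` Poly_Mapping.keys P))"

definition is_reduced :: "nat \<Rightarrow> (nat \<Rightarrow> 'a set) \<Rightarrow> 'a::zero mpoly \<Rightarrow> bool" where
  "is_reduced n K P \<longleftrightarrow>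
     (\<forall>m \<in> Poly_Mapping.keys P. Poly_Mapping.keys m \<subseteq> {..<n} \<and>
        (\<forall>i<n. Poly_Mapping.lookup m i < card (K i)))"

(* Functions on a set X are represented by the extensional functions on X, so that equality of
   HOL functions is equality of functions on X. *)

definition fun_space :: "nat \<Rightarrow> (nat \<Rightarrow> 'a set) \<Rightarrow> ('a vec \<Rightarrow> 'a) set" where
  "fun_space n K = cart n K \<rightarrow>\<^sub>E UNIV"

definition zero_fun :: "nat \<Rightarrow> (nat \<Rightarrow> 'a set) \<Rightarrow> 'a vec \<Rightarrow> 'a::zero" where
  "zero_fun n K = (\<lambda>x \<in> cart n K. 0)"

(* Meaningful for finite nonempty K i, where exactly one such polynomial exists
   (interpolation on a finite grid). *)
definition reduced_poly ::
    "nat \<Rightarrow> (nat \<Rightarrow> 'a set) \<Rightarrow> ('a vec \<Rightarrow> 'a) \<Rightarrow> 'a::comm_semiring_1 mpoly" where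
  "reduced_poly n K f = (THE P. is_reduced n K P \<and> (\<forall>x \<in> cart n K. f x = mpoly_eval P x))"

definition fun_degree ::
    "nat \<Rightarrow> (nat \<Rightarrow> 'a set) \<Rightarrow> ('a vec \<Rightarrow> 'a::comm_semiring_1) \<Rightarrow> nat" where
  "fun_degree n K f = mpoly_degree (reduced_poly n K f)"

definition code :: "nat \<Rightarrow> (nat \<Rightarrow> 'a set) \<Rightarrow> nat \<Rightarrow> ('a vec \<Rightarrow> 'a::comm_semiring_1) set" where
  "code n K d = {f \<in> fun_space n K. f = zero_fun n K \<or> fun_degree n K f \<le> d}"

definition weight :: "nat \<Rightarrow> (nat \<Rightarrow> 'a set) \<Rightarrow> ('a vec \<Rightarrow> 'a::zero) \<Rightarrow> nat" where
  "weight n K f = card {x \<in> cart n K. f x \<noteq> 0}"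

definition min_dist :: "nat \<Rightarrow> (nat \<Rightarrow> 'a::comm_semiring_1 set) \<Rightarrow> nat \<Rightarrow> nat" where
  "min_dist n K d = Min (weight n K ` (code n K d - {zero_fun n K}))"

definition Aff :: "nat \<Rightarrow> ('a::comm_ring_1 vec \<Rightarrow> 'a vec) set" where
  "Aff n = {\<lambda>\<alpha> \<in> carrier_vec n. A *\<^sub>v \<alpha> + \<beta> | A \<beta>.
              A \<in> carrier_mat n n \<and> invertible_mat A \<and> \<beta> \<in> carrier_vec n}"

definition Aff_on :: "nat \<Rightarrow> (nat \<Rightarrow> 'a set) \<Rightarrow> ('a::comm_ring_1 vec \<Rightarrow> 'a vec) set" where
  "Aff_on n K = {restrict \<psi> (cart n K) | \<psi>. \<psi> \<in> Aff n \<and> \<psi> ` cart n K = cart n K}"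

definition equivalent_on ::
    "nat \<Rightarrow> (nat \<Rightarrow> 'a set) \<Rightarrow> ('a vec \<Rightarrow> 'a::comm_ring_1) \<Rightarrow> ('a vec \<Rightarrow> 'a) \<Rightarrow> bool" where
  "equivalent_on n K f g \<longleftrightarrow> (\<exists>\<phi> \<in> Aff_on n K. f = compose (cart n K) g \<phi>)"

end

(* A function of degree at most d restricts to functions of degree at most d on the slices x_0 = a,
   and if it vanishes on t slices, then dividing by the t linear factors lowers the degree on the
   others by t. By induction on n this gives the Alon-Furedi lower bound for weights. In the extremal
   case it forces the support either to lie in one slice or to meet all slices equally often, and the
   same holds for every coordinate function of an affine automorphism of the grid in place of x_0. In
   the second case the induction hypothesis for the slice x_0 = 0 yields a form l that vanishes on the
   support there; comparing the hyperplanes l + c x_0 = 0 with x_0 = 0 shows that equal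
   distribution over all of them is impossible. So the support lies in a hyperplane, and
   dividing out one coordinate reduces n and k by one. *)
theory Submission
  imports Defs
begin

subsection \<open>Polynomial functions on a grid\<close>

text \<open>Degree is measured by any polynomial representing the function, not by the reduced one:
  such a bound survives slicing, division and affine substitution, whereas reducedness would have to
  be restored each time. Reduced polynomials enter only at the end, where
  \<open>x ^ card (K i) = x\<close> and a count identify both notions. With
  \<open>m = k + 1\<close>, the dichotomy is a concavity effect. If \<open>u\<close> slices meet the
  support and \<open>D = card (K m)\<close>, extremality gives \<open>u * (D - u + 1) <= D\<close>,
  that is, \<open>(u - 1) * (D - u) <= 0\<close>, so only \<open>u = 1\<close> and
  \<open>u = D\<close> remain. The second value forces \<open>card (K 0) = D\<close>, and nested
  subfields then give \<open>K 0 = ... = K m\<close>. This equality does two things: the slice x_0 =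
  0 is again extremal for the same \<open>m\<close>, so the induction hypothesis applies to it; and
  l + c x_0 becomes a coordinate of an automorphism of the grid, since the first two coordinates can
  be mixed once they range over the same field. If \<open>m = n\<close> there is no side
  \<open>m\<close>, and the support is a single point.\<close>

text \<open>Functions agreeing on the grid with some polynomial of total degree at most \<open>d\<close>,
  not necessarily a reduced one.\<close>

inductive polyfun :: "nat \<Rightarrow> (nat \<Rightarrow> 'a set) \<Rightarrow> nat \<Rightarrow> ('a vec \<Rightarrow> 'a::field) \<Rightarrow> bool"
  for n K where
  const: "polyfun n K d (\<lambda>x. c)"
| add: "polyfun n K d f \<Longrightarrow> polyfun n K d g \<Longrightarrow> polyfun n K d (\<lambda>x. f x + g x)"
| var: "i < n \<Longrightarrow> polyfun n K d f \<Longrightarrow> polyfun n K (Suc d) (\<lambda>x. x $ i * f x)"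
| cong: "polyfun n K d f \<Longrightarrow> (\<And>x. x \<in> cart n K \<Longrightarrow> f x = g x) \<Longrightarrow> polyfun n K d g"

lemma polyfun_mono:
  assumes "polyfun n K d f" "d \<le> e"
  shows "polyfun n K e f"
  using assms
proof (induction arbitrary: e rule: polyfun.induct)
  case (var i d f)
  then obtain e' where "e = Suc e'" "d \<le> e'" by (cases e) auto
  then show ?case using var polyfun.var by blast
qed (auto intro: polyfun.intros)

lemma polyfun_scale:
  assumes "polyfun n K d f"
  shows "polyfun n K d (\<lambda>x. c * f x)"
  using assms
proof (induction rule: polyfun.induct)
  case (add d f g)
  then have "polyfun n K d (\<lambda>x. c * f x + c * g x)" by (intro polyfun.add)
  then show ?case by (simp add: distrib_left)
next
  case (var i d f)
  then have "polyfun n K (Suc d) (\<lambda>x. x $ i * (c * f x))" by (intro polyfun.var)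
  then show ?case by (simp add: mult.left_commute)
qed (auto intro: polyfun.intros)

lemma polyfun_mult:
  assumes "polyfun n K d f" "polyfun n K e g"
  shows "polyfun n K (d + e) (\<lambda>x. f x * g x)"
  using assms(1)
proof (induction rule: polyfun.induct)
  case (const d c)
  show ?case using assms(2) by (intro polyfun_scale polyfun_mono[OF assms(2)]) auto
next
  case (add d f h)
  then have "polyfun n K (d + e) (\<lambda>x. f x * g x + h x * g x)" by (intro polyfun.add)
  then show ?case by (simp add: distrib_right)
next
  case (var i d f)
  then have "polyfun n K (Suc (d + e)) (\<lambda>x. x $ i * (f x * g x))" by (intro polyfun.var)
  then show ?case by (simp add: mult.assoc)
next
  case (cong d f h)
  then show ?case by (auto intro: polyfun.cong[OF cong.IH])
qed

lemma polyfun_sum: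
  assumes "\<And>s. s \<in> S \<Longrightarrow> polyfun n K d (f s)"
  shows "polyfun n K d (\<lambda>x. \<Sum>s\<in>S. f s x)"
  using assms
  by (induction S rule: infinite_finite_induct) (auto intro: polyfun.intros)

lemma polyfun_power:
  "polyfun n K d f \<Longrightarrow> polyfun n K (e * d) (\<lambda>x. f x ^ e)"
  by (induction e) (auto intro: polyfun.const polyfun_mult)

lemma polyfun_prod:
  assumes "\<And>s. s \<in> S \<Longrightarrow> polyfun n K (d s) (f s)"
  shows "polyfun n K (\<Sum>s\<in>S. d s) (\<lambda>x. \<Prod>s\<in>S. f s x)"
  using assms
  by (induction S rule: infinite_finite_induct) (auto intro: polyfun.const polyfun_mult)

lemma polyfun_coord: "i < n \<Longrightarrow> polyfun n K 1 (\<lambda>x. x $ i)"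
  using polyfun.var[OF _ polyfun.const[of n K 0 1]] by simp

lemma polyfun_degree_0:
  assumes "polyfun n K 0 f"
  shows "\<exists>c. \<forall>x\<in>cart n K. f x = c"
proof -
  have "d = 0 \<longrightarrow> (\<exists>c. \<forall>x\<in>cart n K. f x = c)" if "polyfun n K d f" for d
    using that by (induction rule: polyfun.induct) auto
  then show ?thesis using assms by blast
qed

section \<open>Slices along the first coordinate, and division by linear factors\<close>

lemma vCons_in_cart [simp]:
  "vCons a y \<in> cart (Suc n) K \<longleftrightarrow> a \<in> K 0 \<and> y \<in> cart n (\<lambda>i. K (Suc i))"
proof -
  have "(\<forall>i<Suc n. vCons a y $ i \<in> K i) \<longleftrightarrow> a \<in> K 0 \<and> (\<forall>i<n. y $ i \<in> K (Suc i))"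
    if "y \<in> carrier_vec n"
    using that by (auto simp: vec_index_vCons less_Suc_eq_0_disj)
  then show ?thesis by (auto simp: cart_def)
qed

lemma cart_Suc_cases:
  assumes "x \<in> cart (Suc n) K"
  obtains a y where "x = vCons a y" "a \<in> K 0" "y \<in> cart n (\<lambda>i. K (Suc i))"
proof (cases x)
  case vNil
  then show ?thesis using assms by (auto simp: cart_def)
next
  case (vCons a y)
  then show ?thesis using assms that by auto
qed

lemma cart_0 [simp]: "cart 0 K = {vNil}"
  by (auto simp: cart_def)

lemma finite_cart: "\<forall>i<n. finite (K i) \<Longrightarrow> finite (cart n K)"
proof (induction n arbitrary: K)
  case (Suc n)
  have "cart (Suc n) K \<subseteq> (\<lambda>(a, y). vCons a y) ` (K 0 \<times> cart n (\<lambda>i. K (Suc i)))"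
    by (auto elim!: cart_Suc_cases)
  moreover have "finite (cart n (\<lambda>i. K (Suc i)))" using Suc by auto
  ultimately show ?case using Suc.prems by (meson finite_SigmaI finite_imageI finite_subset zero_less_Suc)
qed simp

lemma weight_Suc:
  assumes "\<forall>i<Suc n. finite (K i)"
  shows "weight (Suc n) K f = (\<Sum>a\<in>K 0. weight n (\<lambda>i. K (Suc i)) (\<lambda>y. f (vCons a y)))"
proof -
  let ?S = "\<lambda>a. {y \<in> cart n (\<lambda>i. K (Suc i)). f (vCons a y) \<noteq> 0}"
  have "{x \<in> cart (Suc n) K. f x \<noteq> 0} = (\<lambda>(a, y). vCons a y) ` (SIGMA a:K 0. ?S a)"
    by (force elim!: cart_Suc_cases)
  moreover have "inj_on (\<lambda>(a, y). vCons a y) (SIGMA a:K 0. ?S a)"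
    by (auto simp: inj_on_def)
  moreover have "finite (cart n (\<lambda>i. K (Suc i)))" using assms by (intro finite_cart) auto
  ultimately show ?thesis using assms
    by (simp add: weight_def card_image)
qed

lemma polyfun_slice:
  assumes "polyfun (Suc n) K d f" "a \<in> K 0"
  shows "polyfun n (\<lambda>i. K (Suc i)) d (\<lambda>y. f (vCons a y))"
  using assms(1)
proof (induction rule: polyfun.induct)
  case (var i d f)
  show ?case
  proof (cases i)
    case 0
    then show ?thesis using polyfun_mono[OF polyfun_scale[OF var.IH, of a]] by simp
  next
    case (Suc j)
    then have "polyfun n (\<lambda>i. K (Suc i)) (Suc d) (\<lambda>y. y $ j * f (vCons a y))"
      using var by (intro polyfun.var) auto
    then show ?thesis by (rule polyfun.cong) (auto simp: Suc vec_index_vCons)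
  qed
next
  case (cong d f g)
  show ?case by (rule polyfun.cong[OF cong.IH]) (use cong assms in auto)
qed (auto intro: polyfun.intros)

text \<open>For \<open>d = 0\<close> the truncated degree \<open>d - 1\<close> is meaningless, hence the extra clause.\<close>

lemma polyfun_div_linear:
  assumes "polyfun (Suc n) K d f" "a \<in> K 0"
  shows "\<exists>h. polyfun (Suc n) K (d - 1) h \<and> (d = 0 \<longrightarrow> (\<forall>x. h x = 0)) \<and>
    (\<forall>b\<in>K 0. \<forall>y\<in>cart n (\<lambda>i. K (Suc i)). f (vCons b y) = f (vCons a y) + (b - a) * h (vCons b y))"
  using assms(1)
proof (induction rule: polyfun.induct)
  case (const d c)
  show ?case by (intro exI[of _ "\<lambda>x. 0"]) (auto intro: polyfun.const)
next
  case (add d f g)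
  then obtain h k where "polyfun (Suc n) K (d - 1) h" "polyfun (Suc n) K (d - 1) k"
    "d = 0 \<longrightarrow> (\<forall>x. h x = 0)" "d = 0 \<longrightarrow> (\<forall>x. k x = 0)"
    "\<forall>b\<in>K 0. \<forall>y\<in>cart n (\<lambda>i. K (Suc i)). f (vCons b y) = f (vCons a y) + (b - a) * h (vCons b y)"
    "\<forall>b\<in>K 0. \<forall>y\<in>cart n (\<lambda>i. K (Suc i)). g (vCons b y) = g (vCons a y) + (b - a) * k (vCons b y)"
    by blast
  then have "f (vCons b y) + g (vCons b y) =
      f (vCons a y) + g (vCons a y) + (b - a) * (h (vCons b y) + k (vCons b y))"
    if "b \<in> K 0" "y \<in> cart n (\<lambda>i. K (Suc i))" for b y
    using that by (simp add: distrib_left)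
  moreover have "polyfun (Suc n) K (d - 1) (\<lambda>x. h x + k x)"
    by (intro polyfun.add) fact+
  ultimately show ?case
    using \<open>d = 0 \<longrightarrow> (\<forall>x. h x = 0)\<close> \<open>d = 0 \<longrightarrow> (\<forall>x. k x = 0)\<close>
    by (intro exI[of _ "\<lambda>x. h x + k x"]) simp
next
  case (var i d f)
  then obtain h where h: "polyfun (Suc n) K (d - 1) h" "d = 0 \<longrightarrow> (\<forall>x. h x = 0)"
    "\<forall>b\<in>K 0. \<forall>y\<in>cart n (\<lambda>i. K (Suc i)). f (vCons b y) = f (vCons a y) + (b - a) * h (vCons b y)"
    by blast
  have h': "polyfun (Suc n) K d (\<lambda>x. c * h x)" for c
    using h(1) by (intro polyfun_scale polyfun_mono[OF h(1)]) auto
  \<comment> \<open>For \<open>d = 0\<close> the bound \<open>d - 1\<close> is 0, so multiplying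
    \<open>h\<close> by a coordinate would only give degree 1; the clause that \<open>h\<close>
    vanishes closes this gap.\<close>
  have xh: "polyfun (Suc n) K d (\<lambda>x. x $ i * h x)"
  proof (cases d)
    case 0
    then show ?thesis using h(2) by (simp add: polyfun.const)
  next
    case (Suc e)
    then show ?thesis using h(1) polyfun.var[OF var.hyps(1), of K e h] by simp
  qed
  show ?case
  proof (cases i)
    case 0
    \<comment> \<open>The quotient comes from the product rule for differences: b f(b) - a f(a) = (b
      - a) f(b) + a (f(b) - f(a)).\<close>
    have "polyfun (Suc n) K d (\<lambda>x. f x + a * h x)"
      using var.hyps h' by (intro polyfun.add)
    moreover have "b * f (vCons b y) =
        a * f (vCons a y) + (b - a) * (f (vCons b y) + a * h (vCons b y))"
      if "b \<in> K 0" "y \<in> cart n (\<lambda>i. K (Suc i))" for b y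
      unfolding h(3)[rule_format, OF that] by (simp add: algebra_simps)
    ultimately show ?thesis using 0
      by (intro exI[of _ "\<lambda>x. f x + a * h x"]) simp
  next
    case (Suc j)
    have "y $ j * f (vCons b y) = y $ j * f (vCons a y) + (b - a) * (y $ j * h (vCons b y))"
      if "b \<in> K 0" "y \<in> cart n (\<lambda>i. K (Suc i))" for b y
      unfolding h(3)[rule_format, OF that] by (simp add: algebra_simps)
    then show ?thesis using Suc xh
      by (intro exI[of _ "\<lambda>x. x $ i * h x"]) (simp add: vec_index_vCons)
  qed
next
  case (cong d f g)
  then obtain h where h: "polyfun (Suc n) K (d - 1) h" "d = 0 \<longrightarrow> (\<forall>x. h x = 0)"
    "\<forall>b\<in>K 0. \<forall>y\<in>cart n (\<lambda>i. K (Suc i)). f (vCons b y) = f (vCons a y) + (b - a) * h (vCons b y)"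
    by blast
  then show ?case using cong.hyps(2) assms(2)
    by (intro exI[of _ h]) (metis vCons_in_cart)
qed

text \<open>Roots are divided out one at a time: the product of the factors already removed is
  nonzero at a new root, so the remaining quotient still vanishes on that slice. The point
  \<open>x\<close> with \<open>f x \<noteq> 0\<close> is what bounds the number of roots by the
  degree.\<close>

lemma polyfun_factor_roots:
  assumes "finite T" "T \<subseteq> K 0" "polyfun (Suc n) K d f"
    and "\<And>a y. a \<in> T \<Longrightarrow> y \<in> cart n (\<lambda>i. K (Suc i)) \<Longrightarrow> f (vCons a y) = 0"
    and "x \<in> cart (Suc n) K" "f x \<noteq> 0"
  shows "card T \<le> d \<and> (\<exists>h. polyfun (Suc n) K (d - card T) h \<and>
    (\<forall>b\<in>K 0. \<forall>y\<in>cart n (\<lambda>i. K (Suc i)). f (vCons b y) = (\<Prod>a\<in>T. b - a) * h (vCons b y)))"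
  using assms(1,2,4)
proof (induction T rule: finite_induct)
  case empty
  then show ?case using assms(3) by (intro conjI exI[of _ f]) auto
next
  case (insert a T)
  then obtain h where h: "card T \<le> d" "polyfun (Suc n) K (d - card T) h"
    "\<forall>b\<in>K 0. \<forall>y\<in>cart n (\<lambda>i. K (Suc i)). f (vCons b y) = (\<Prod>a\<in>T. b - a) * h (vCons b y)"
    by auto
  have aK: "a \<in> K 0" using insert.prems by simp
  obtain g where g: "polyfun (Suc n) K (d - card T - 1) g" "d - card T = 0 \<longrightarrow> (\<forall>x. g x = 0)"
    "\<forall>b\<in>K 0. \<forall>y\<in>cart n (\<lambda>i. K (Suc i)). h (vCons b y) = h (vCons a y) + (b - a) * g (vCons b y)"
    using polyfun_div_linear[OF h(2) aK] by (elim exE conjE) (rule that)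
  have nz: "(\<Prod>c\<in>T. a - c) \<noteq> 0" using insert.hyps by auto
  have "h (vCons a y) = 0" if "y \<in> cart n (\<lambda>i. K (Suc i))" for y
    using insert.prems(2)[of a y] h(3) that nz insert.prems(1) by auto
  then have g3: "\<forall>b\<in>K 0. \<forall>y\<in>cart n (\<lambda>i. K (Suc i)). f (vCons b y) = (\<Prod>c\<in>insert a T. b - c) * g (vCons b y)"
    using h(3) g(3) insert.hyps by (simp add: mult_ac)
  \<comment> \<open>If the degree were already exhausted, the next quotient \<open>g\<close> would
    be identically zero and \<open>f\<close> would vanish at \<open>x\<close>.\<close>
  have "card T < d"
  proof (rule ccontr)
    assume "\<not> card T < d"
    then have "\<forall>x. g x = 0" using g(2) h(1) by simp
    then have "f x = 0" using g3 assms(5) by (auto elim!: cart_Suc_cases)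
    then show False using assms(6) by simp
  qed
  then show ?case using g(1) g3 insert.hyps by (intro conjI exI[of _ g]) auto
qed

subsection \<open>The minimum weight bound and its equality case\<close>

text \<open>The least weight of a nonzero polynomial function of degree at most \<open>d\<close> on a grid
  with side lengths \<open>s 0 \<le> s 1 \<le> \<dots>\<close>: the degree is spent on the shortest sides first.\<close>

fun grid_bound :: "nat \<Rightarrow> (nat \<Rightarrow> nat) \<Rightarrow> nat \<Rightarrow> nat" where
  "grid_bound 0 s d = 1"
| "grid_bound (Suc n) s d =
    (if s 0 - 1 \<le> d then grid_bound n (\<lambda>i. s (Suc i)) (d - (s 0 - 1))
     else (s 0 - d) * (\<Prod>i<n. s (Suc i)))"

text \<open>For equal sums, \<open>u * v - D * E = (u - D) * (E - u)\<close>: the product is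
  smallest at the ends of the interval.\<close>

lemma mult_ge_of_sum_eq:
  fixes u v D E :: nat
  assumes "u + v = D + E" "D \<le> u" "u \<le> E"
  shows "D * E \<le> u * v"
proof -
  obtain p where p: "u = D + p" using assms(2) le_Suc_ex by blast
  then have "v + p = E" "p \<le> E - D" using assms by auto
  then obtain r where "v = D + r" "E = D + r + p" using assms p
    by (metis add.assoc add.commute le_Suc_ex add_left_cancel)
  then show ?thesis using p by (simp add: algebra_simps)
qed

text \<open>Raising the degree by \<open>u - 1\<close> divides the bound by at most
  \<open>u\<close>. When the two degrees stop on the same side or on neighbouring sides, the bounds
  differ in a pair of factors with equal sum, which \<open>mult_ge_of_sum_eq\<close> compares;
  \<open>u \<le> s 0\<close> keeps the overflow within the next side.\<close>

lemma grid_bound_split: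
  assumes "\<And>i j. i \<le> j \<Longrightarrow> j < n \<Longrightarrow> s i \<le> s j" "0 < n \<Longrightarrow> u \<le> s 0" "1 \<le> u"
  shows "grid_bound n s e \<le> u * grid_bound n s (e + u - 1)"
  using assms
proof (induction n arbitrary: s e)
  case 0
  then show ?case by simp
next
  case (Suc n)
  note mono = Suc.prems(1)
  have u: "1 \<le> u" "u \<le> s 0" using Suc.prems by auto
  let ?P = "\<Prod>i<n. s (Suc i)"
  consider "s 0 - 1 \<le> e" | "e < s 0 - 1" "s 0 - 1 \<le> e + u - 1" | "e + u - 1 < s 0 - 1"
    by linarith
  then show ?case
  proof cases
    case 1
    have "grid_bound n (\<lambda>i. s (Suc i)) (e - (s 0 - 1)) \<le> u * grid_bound n (\<lambda>i. s (Suc i)) (e - (s 0 - 1) + u - 1)"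
    proof (rule Suc.IH)
      show "u \<le> s (Suc 0)" if "0 < n" using mono[of 0 1] u that by simp
    qed (use mono u in auto)
    moreover have "e + u - 1 - (s 0 - 1) = e - (s 0 - 1) + u - 1" "s 0 - 1 \<le> e + u - 1"
      using 1 u by linarith+
    ultimately show ?thesis using 1 by simp
  next
    \<comment> \<open>The larger degree exceeds the share of the first side and spends
      \<open>?r\<close> on the second one.\<close>
    case 2
    let ?r = "e + u - s 0"
    have "(s 0 - e) * ?P \<le> u * grid_bound n (\<lambda>i. s (Suc i)) ?r"
    proof (cases n)
      case 0
      then show ?thesis using 2 u by simp
    next
      case (Suc m)
      have le: "s 0 \<le> s 1" using mono[of 0 1] Suc by simp
      have r: "?r < s 1 - 1" using 2 u le by linarith
      have "(s 0 - e) * s 1 \<le> u * (s 1 - ?r)"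
        using 2 u le by (intro mult_ge_of_sum_eq) linarith+
      then have "(s 0 - e) * (s 1 * (\<Prod>i<m. s (Suc (Suc i)))) \<le> u * ((s 1 - ?r) * (\<Prod>i<m. s (Suc (Suc i))))"
        by (metis mult.assoc mult_le_mono1)
      moreover have "grid_bound n (\<lambda>i. s (Suc i)) ?r = (s 1 - ?r) * (\<Prod>i<m. s (Suc (Suc i)))"
        using r Suc by simp
      ultimately show ?thesis using Suc prod.lessThan_Suc_shift[of "\<lambda>i. s (Suc i)" m] by (simp add: o_def)
    qed
    moreover have "e + u - 1 - (s 0 - 1) = ?r" using u by linarith
    ultimately show ?thesis using 2 by simp
  next
    case 3
    have "u + (s 0 - (e + u - 1)) = 1 + (s 0 - e)" using u 3 by linarith
    then have "1 * (s 0 - e) \<le> u * (s 0 - (e + u - 1))"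
      using u 3 by (intro mult_ge_of_sum_eq) linarith+
    then have "(s 0 - e) * ?P \<le> u * ((s 0 - (e + u - 1)) * ?P)"
      by (metis mult.assoc mult_le_mono1 mult_1)
    then show ?thesis using 3 u by auto
  qed
qed

text \<open>This is the induction step of the weight bound: \<open>t\<close> of the
  \<open>s 0\<close> slices vanish, and the other \<open>u\<close> keep degree \<open>d - t\<close>
  after division. If the degree covers the first side, then \<open>d - t\<close> is
  \<open>u - 1\<close> more than what is left after that side, which is the situation of
  \<open>grid_bound_split\<close>.\<close>

lemma grid_bound_Suc_le:
  assumes "\<And>i j. i \<le> j \<Longrightarrow> j < Suc n \<Longrightarrow> s i \<le> s j" "1 \<le> u" "u + t = s 0" "t \<le> d"
  shows "grid_bound (Suc n) s d \<le> u * grid_bound n (\<lambda>i. s (Suc i)) (d - t)"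
proof (cases "s 0 - 1 \<le> d")
  case True
  have "grid_bound n (\<lambda>i. s (Suc i)) (d - (s 0 - 1)) \<le> u * grid_bound n (\<lambda>i. s (Suc i)) (d - (s 0 - 1) + u - 1)"
  proof (rule grid_bound_split)
    show "u \<le> s (Suc 0)" if "0 < n" using assms(1)[of 0 1] assms(3) that by simp
  qed (use assms in auto)
  moreover have "d - (s 0 - 1) + u - 1 = d - t" using True assms by linarith
  ultimately show ?thesis using True by simp
next
  case False
  have "(s 0 - d) * (\<Prod>i<n. s (Suc i)) \<le> u * grid_bound n (\<lambda>i. s (Suc i)) (d - t)"
  proof (cases n)
    case 0
    then show ?thesis using assms False by simp
  next
    case (Suc m)
    have le: "s 0 \<le> s 1" using assms(1)[of 0 1] Suc by simp
    have "(s 0 - d) * s 1 \<le> u * (s 1 - (d - t))"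
      using assms le False by (intro mult_ge_of_sum_eq) linarith+
    then have "(s 0 - d) * (s 1 * (\<Prod>i<m. s (Suc (Suc i)))) \<le> u * ((s 1 - (d - t)) * (\<Prod>i<m. s (Suc (Suc i))))"
      by (metis mult.assoc mult_le_mono1)
    moreover have "grid_bound n (\<lambda>i. s (Suc i)) (d - t) = (s 1 - (d - t)) * (\<Prod>i<m. s (Suc (Suc i)))"
    proof -
      have "\<not> s 1 - 1 \<le> d - t" using False le assms by linarith
      then show ?thesis using Suc by simp
    qed
    ultimately show ?thesis using Suc prod.lessThan_Suc_shift[of "\<lambda>i. s (Suc i)" m] by (simp add: o_def)
  qed
  then show ?thesis using False by simp
qed

text \<open>The first \<open>m\<close> sides are used up and \<open>r\<close> is spent on side
  \<open>m\<close>. The value \<open>r = s m - 1\<close> uses up side \<open>m\<close> as well; the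
  formula stays right because the leading factor becomes 1, but the recursion then continues with
  degree 0, which \<open>all\<close> evaluates.\<close>

lemma grid_bound_eq:
  assumes "m < n" "r < s m" "\<And>i. i < n \<Longrightarrow> 1 \<le> s i"
  shows "grid_bound n s ((\<Sum>i<m. s i - 1) + r) = (s m - r) * (\<Prod>i\<in>{m<..<n}. s i)"
  using assms
proof (induction n arbitrary: s m)
  case (Suc n)
  show ?case
  proof (cases m)
    case 0
    have P: "(\<Prod>i\<in>{0<..<Suc n}. s i) = (\<Prod>i<n. s (Suc i))"
      by (rule prod.reindex_bij_witness[of _ Suc "\<lambda>i. i - 1"]) auto
    have all: "grid_bound k s' 0 = (\<Prod>i<k. s' i)" if "\<forall>i<k. 1 \<le> s' i" for k s'
      using that
    proof (induction k arbitrary: s')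
      case (Suc k)
      then show ?case using prod.lessThan_Suc_shift[of s' k]
        by (auto simp: o_def le_Suc_eq)
    qed simp
    show ?thesis
    proof (cases "s 0 - 1 \<le> r")
      case True
      then have "r = s 0 - 1" "s 0 - r = 1" using Suc.prems 0 by auto
      then show ?thesis using P 0 Suc.prems all[of n "\<lambda>i. s (Suc i)"] by simp
    next
      case False
      then show ?thesis using P 0 by simp
    qed
  next
    case (Suc l)
    have "(\<Prod>i\<in>{m<..<Suc n}. s i) = (\<Prod>i\<in>{l<..<n}. s (Suc i))"
      using Suc by (intro prod.reindex_bij_witness[of _ Suc "\<lambda>i. i - 1"]) auto
    moreover have "(\<Sum>i<m. s i - 1) = (s 0 - 1) + (\<Sum>i<l. s (Suc i) - 1)"
      using sum.lessThan_Suc_shift[of "\<lambda>i. s i - 1" l] by (simp only: Suc)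
    ultimately show ?thesis using Suc.IH[of l "\<lambda>i. s (Suc i)"] Suc.prems Suc
      by (simp only: grid_bound.simps add.assoc) simp
  qed
qed simp

text \<open>The slices \<open>x\<^sub>0 = a\<close> on which \<open>f\<close> vanishes can be divided out, which lowers the degree of
  the remaining slices accordingly.\<close>

lemma nonzero_slices:
  assumes "\<forall>i<Suc n. finite (K i)" "polyfun (Suc n) K d f"
    and "x \<in> cart (Suc n) K" "f x \<noteq> 0"
  defines "U \<equiv> {a \<in> K 0. \<exists>y\<in>cart n (\<lambda>i. K (Suc i)). f (vCons a y) \<noteq> 0}"
  shows "U \<noteq> {}" "card U + card (K 0 - U) = card (K 0)" "card (K 0 - U) \<le> d"
    and "weight (Suc n) K f = (\<Sum>a\<in>U. weight n (\<lambda>i. K (Suc i)) (\<lambda>y. f (vCons a y)))"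
    and "\<And>a. a \<in> U \<Longrightarrow> \<exists>g. polyfun n (\<lambda>i. K (Suc i)) (d - card (K 0 - U)) g \<and>
      weight n (\<lambda>i. K (Suc i)) (\<lambda>y. f (vCons a y)) = weight n (\<lambda>i. K (Suc i)) g \<and>
      (\<exists>y\<in>cart n (\<lambda>i. K (Suc i)). g y \<noteq> 0)"
proof -
  have fin: "finite (K 0)" "U \<subseteq> K 0" using assms(1) by (auto simp: U_def)
  show "U \<noteq> {}" using assms(3,4) by (auto simp: U_def elim!: cart_Suc_cases)
  show "card U + card (K 0 - U) = card (K 0)"
    using fin by (metis card_Diff_subset card_mono finite_subset le_add_diff_inverse)
  have *: "card (K 0 - U) \<le> d \<and> (\<exists>h. polyfun (Suc n) K (d - card (K 0 - U)) h \<and>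
    (\<forall>b\<in>K 0. \<forall>y\<in>cart n (\<lambda>i. K (Suc i)). f (vCons b y) = (\<Prod>a\<in>K 0 - U. b - a) * h (vCons b y)))"
    using fin by (intro polyfun_factor_roots[OF _ _ assms(2) _ assms(3,4)]) (auto simp: U_def)
  then show "card (K 0 - U) \<le> d" by simp
  have "weight n (\<lambda>i. K (Suc i)) (\<lambda>y. f (vCons a y)) = 0" if "a \<in> K 0 - U" for a
    using that unfolding weight_def U_def by (intro card_eq_0_iff[THEN iffD2] disjI1) auto
  then show "weight (Suc n) K f = (\<Sum>a\<in>U. weight n (\<lambda>i. K (Suc i)) (\<lambda>y. f (vCons a y)))"
    using fin by (subst weight_Suc[OF assms(1)])
      (auto intro!: sum.mono_neutral_right)
  obtain h where h: "polyfun (Suc n) K (d - card (K 0 - U)) h"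
    "\<forall>b\<in>K 0. \<forall>y\<in>cart n (\<lambda>i. K (Suc i)). f (vCons b y) = (\<Prod>a\<in>K 0 - U. b - a) * h (vCons b y)"
    using * by blast
  fix a assume a: "a \<in> U"
  \<comment> \<open>On a slice with \<open>a \<in> U\<close> the removed factors are a nonzero
    constant, so \<open>f\<close> and \<open>h\<close> have the same support there.\<close>
  have nz: "(\<Prod>b\<in>K 0 - U. a - b) \<noteq> 0" using a fin by auto
  have "f (vCons a y) \<noteq> 0 \<longleftrightarrow> h (vCons a y) \<noteq> 0" if "y \<in> cart n (\<lambda>i. K (Suc i))" for y
    using h(2) nz a fin that by auto
  then have "{y \<in> cart n (\<lambda>i. K (Suc i)). f (vCons a y) \<noteq> 0} = {y \<in> cart n (\<lambda>i. K (Suc i)). h (vCons a y) \<noteq> 0}"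
    by auto
  moreover have "\<exists>y\<in>cart n (\<lambda>i. K (Suc i)). f (vCons a y) \<noteq> 0" using a by (auto simp: U_def)
  ultimately show "\<exists>g. polyfun n (\<lambda>i. K (Suc i)) (d - card (K 0 - U)) g \<and>
      weight n (\<lambda>i. K (Suc i)) (\<lambda>y. f (vCons a y)) = weight n (\<lambda>i. K (Suc i)) g \<and>
      (\<exists>y\<in>cart n (\<lambda>i. K (Suc i)). g y \<noteq> 0)"
    using polyfun_slice[OF h(1)] a fin
    by (intro exI[of _ "\<lambda>y. h (vCons a y)"]) (auto simp: weight_def)
qed

text \<open>All nonvanishing slices share one degree bound, so the induction hypothesis gives the
  same estimate for each, and \<open>grid_bound_Suc_le\<close> compares their sum with the bound for
  the whole grid.\<close>

theorem weight_ge_grid_bound: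
  assumes "\<forall>i<n. finite (K i)" "\<And>i j. i \<le> j \<Longrightarrow> j < n \<Longrightarrow> card (K i) \<le> card (K j)"
    and "polyfun n K d f" "x \<in> cart n K" "f x \<noteq> 0"
  shows "grid_bound n (\<lambda>i. card (K i)) d \<le> weight n K f"
  using assms
proof (induction n arbitrary: K d f x)
  case 0
  then have "{x \<in> cart 0 K. f x \<noteq> 0} = {vNil}" by auto
  then show ?case by (simp only: weight_def) simp
next
  case (Suc n)
  define U where "U = {a \<in> K 0. \<exists>y\<in>cart n (\<lambda>i. K (Suc i)). f (vCons a y) \<noteq> 0}"
  note U = nonzero_slices[OF Suc.prems(1,3-5), folded U_def]
  have "finite U" using Suc.prems(1) by (auto simp: U_def)
  have "grid_bound n (\<lambda>i. card (K (Suc i))) (d - card (K 0 - U)) \<le> weight n (\<lambda>i. K (Suc i)) (\<lambda>y. f (vCons a y))"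
    if aU: "a \<in> U" for a
  proof -
    obtain g y where g: "polyfun n (\<lambda>i. K (Suc i)) (d - card (K 0 - U)) g"
      "weight n (\<lambda>i. K (Suc i)) (\<lambda>y. f (vCons a y)) = weight n (\<lambda>i. K (Suc i)) g"
      "y \<in> cart n (\<lambda>i. K (Suc i))" "g y \<noteq> 0" using U(5)[OF aU] by blast
    then show ?thesis using g Suc.prems Suc.IH[of "\<lambda>i. K (Suc i)" _ g y] by simp
  qed
  then have "card U * grid_bound n (\<lambda>i. card (K (Suc i))) (d - card (K 0 - U)) \<le> weight (Suc n) K f"
    unfolding U(4) using sum_bounded_below[of U "grid_bound n (\<lambda>i. card (K (Suc i))) (d - card (K 0 - U))"] by simp
  moreover have "grid_bound (Suc n) (\<lambda>i. card (K i)) d \<le> card U * grid_bound n (\<lambda>i. card (K (Suc i))) (d - card (K 0 - U))"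
    using Suc.prems U \<open>finite U\<close> by (intro grid_bound_Suc_le) (auto simp: Suc_le_eq card_gt_0_iff)
  ultimately show ?case by linarith
qed

section \<open>The equality case: one slice or all slices\<close>

lemma weight_slice:
  assumes "a \<in> K 0"
  shows "weight n (\<lambda>i. K (Suc i)) (\<lambda>y. f (vCons a y)) =
    card {x \<in> cart (Suc n) K. f x \<noteq> 0 \<and> x $ 0 = a}"
proof -
  have "{x \<in> cart (Suc n) K. f x \<noteq> 0 \<and> x $ 0 = a} =
      vCons a ` {y \<in> cart n (\<lambda>i. K (Suc i)). f (vCons a y) \<noteq> 0}"
    using assms by (auto elim!: cart_Suc_cases)
  then show ?thesis by (simp add: weight_def card_image inj_on_def)
qed

lemma slice_dichotomy:
  assumes "\<forall>i<Suc n. finite (K i)"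
    and "\<And>i j. i \<le> j \<Longrightarrow> j < Suc n \<Longrightarrow> card (K i) \<le> card (K j)"
    and "0 < m" "m < Suc n" "polyfun (Suc n) K (\<Sum>i<m. card (K i) - 1) f"
    and "x \<in> cart (Suc n) K" "f x \<noteq> 0"
    and "weight (Suc n) K f \<le> (\<Prod>i\<in>{m..<Suc n}. card (K i))"
  shows "(\<exists>a\<in>K 0. \<forall>z\<in>cart (Suc n) K. f z \<noteq> 0 \<longrightarrow> z $ 0 = a) \<or>
    (card (K 0) = card (K m) \<and> (\<forall>a\<in>K 0.
      weight n (\<lambda>i. K (Suc i)) (\<lambda>y. f (vCons a y)) = (\<Prod>i\<in>{m<..<Suc n}. card (K i))))"
proof -
  let ?K = "\<lambda>i. K (Suc i)"
  define D W where "D = card (K m)" and "W = (\<Prod>i\<in>{m<..<Suc n}. card (K i))"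
  define U where "U = {a \<in> K 0. \<exists>y\<in>cart n ?K. f (vCons a y) \<noteq> 0}"
  note U = nonzero_slices[OF assms(1,5-7), folded U_def]
  define u where "u = card U"
  obtain l where l: "m = Suc l" using assms(3) by (cases m) auto
  have fin: "finite U" "U \<subseteq> K 0" using assms(1) by (auto simp: U_def)
  have pos: "0 < card (K i)" if "i < Suc n" for i
    using that assms(1,6) by (auto simp: cart_def card_gt_0_iff)
  have u: "0 < u" "u \<le> card (K 0)" "card (K 0) \<le> D"
    using U(1) fin assms(1,2,4) by (auto simp: u_def D_def card_gt_0_iff card_mono)
  have "(\<Sum>i<m. card (K i) - 1) = (card (K 0) - 1) + (\<Sum>i<l. card (?K i) - 1)"
    using sum.lessThan_Suc_shift[of "\<lambda>i. card (K i) - 1" l] by (simp only: l)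
  \<comment> \<open>The \<open>card (K 0) - u\<close> divided roots fall short of the share
    \<open>card (K 0) - 1\<close> of side 0 by \<open>u - 1\<close>. This surplus lands on side
    \<open>m\<close>, which has index \<open>l\<close> in the slice.\<close>
  then have deg: "(\<Sum>i<m. card (K i) - 1) - card (K 0 - U) = (\<Sum>i<l. card (?K i) - 1) + (u - 1)"
    using U(2) u unfolding u_def by linarith
  have W: "(\<Prod>i\<in>{l<..<n}. card (?K i)) = W"
    unfolding W_def l by (rule prod.reindex_bij_witness[of _ "\<lambda>i. i - 1" Suc]) auto
  have slice: "(D - (u - 1)) * W \<le> weight n ?K (\<lambda>y. f (vCons a y))" if aU: "a \<in> U" for a
  proof -
    obtain g y where g: "polyfun n ?K ((\<Sum>i<l. card (?K i) - 1) + (u - 1)) g"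
      "weight n ?K (\<lambda>y. f (vCons a y)) = weight n ?K g" "y \<in> cart n ?K" "g y \<noteq> 0"
      using U(5)[OF aU] unfolding deg by blast
    have "grid_bound n (\<lambda>i. card (?K i)) ((\<Sum>i<l. card (?K i) - 1) + (u - 1)) \<le> weight n ?K g"
      using assms(1,2) by (intro weight_ge_grid_bound[OF _ _ g(1,3,4)]) auto
    moreover have "grid_bound n (\<lambda>i. card (?K i)) ((\<Sum>i<l. card (?K i) - 1) + (u - 1)) =
        (D - (u - 1)) * W"
      using grid_bound_eq[of l n "u - 1" "\<lambda>i. card (?K i)"] assms(4) u pos W
      by (auto simp: l D_def Suc_le_eq)
    ultimately show ?thesis using g(2) by simp
  qed
  have total: "weight (Suc n) K f \<le> D * W"
  proof -
    have "{m..<Suc n} = insert m {m<..<Suc n}" using assms(4) by auto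
    then show ?thesis using assms(8) by (simp add: D_def W_def)
  qed
  have "0 < W" unfolding W_def using pos by (intro prod_pos) auto
  have "u * ((D - (u - 1)) * W) \<le> weight (Suc n) K f"
    unfolding U(4) u_def using sum_bounded_below[where A=U and K="(D - (card U - 1)) * W"] slice
    by (simp add: u_def)
  then have "u * (D - (u - 1)) \<le> D"
    using total \<open>0 < W\<close> by (metis le_trans mult.assoc mult_le_cancel2)
  \<comment> \<open>With \<open>u = v + 1\<close> and \<open>D = u + p\<close> the inequality reads
    \<open>(v + 1) * (p + 1) \<le> v + 1 + p\<close>, hence \<open>v * p = 0\<close>.\<close>
  moreover obtain p where p: "D = u + p" using u le_Suc_ex le_trans by blast
  moreover obtain v where v: "u = Suc v" using u by (cases u) auto
  ultimately have "v * p = 0" by (simp add: algebra_simps)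
  then consider "u = 1" | "u = D" using p v by auto
  then show ?thesis
  proof cases
    case 1
    then obtain a where a: "U = {a}" unfolding u_def using card_1_singletonE by auto
    have "z $ 0 = a" if z: "z \<in> cart (Suc n) K" "f z \<noteq> 0" for z
    proof -
      have "z $ 0 \<in> U" using z by (auto simp: U_def elim!: cart_Suc_cases)
      then show ?thesis using a by simp
    qed
    moreover have "a \<in> K 0" using a fin by auto
    ultimately show ?thesis by blast
  next
    \<comment> \<open>From \<open>u \<le> card (K 0) \<le> D\<close> all three are equal. Now
      \<open>D - (u - 1) = 1\<close>, so each of the \<open>D\<close> slices has weight at least
      \<open>W\<close>, while the total is at most \<open>D * W\<close>.\<close>
    case 2
    then have eq: "card (K 0) = D" "u = D" using u by auto
    then have UK: "U = K 0" using fin assms(1) u_def by (metis card_subset_eq zero_less_Suc)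
    have low: "W \<le> weight n ?K (\<lambda>y. f (vCons a y))" if "a \<in> K 0" for a
      using slice[of a] that UK eq u by simp
    have "(\<Sum>a\<in>K 0. W) = (\<Sum>a\<in>K 0. weight n ?K (\<lambda>y. f (vCons a y)))"
    proof (rule antisym)
      show "(\<Sum>a\<in>K 0. W) \<le> (\<Sum>a\<in>K 0. weight n ?K (\<lambda>y. f (vCons a y)))"
        by (intro sum_mono low)
      show "(\<Sum>a\<in>K 0. weight n ?K (\<lambda>y. f (vCons a y))) \<le> (\<Sum>a\<in>K 0. W)"
        using total U(4) UK eq by simp
    qed
    then have "W = weight n ?K (\<lambda>y. f (vCons a y))" if "a \<in> K 0" for a
      using sum_mono_inv[OF _ low that] assms(1) by auto
    then show ?thesis using eq by (auto simp: D_def W_def)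
  qed
qed

subsection \<open>Affine automorphisms of a grid\<close>

definition affine_form :: "nat \<Rightarrow> ('a::field vec \<Rightarrow> 'a) \<Rightarrow> bool" where
  "affine_form n g \<longleftrightarrow> (\<exists>c b. \<forall>x\<in>carrier_vec n. g x = (\<Sum>j<n. c j * x $ j) + b)"

lemma affine_form_const: "affine_form n (\<lambda>x. c)"
  unfolding affine_form_def by (rule exI[of _ "\<lambda>j. 0"]) auto

lemma affine_form_coord: "i < n \<Longrightarrow> affine_form n (\<lambda>x. x $ i)"
  unfolding affine_form_def
  by (intro exI[of _ "\<lambda>j. if j = i then 1 else 0"] exI[of _ 0]) (simp add: if_distrib[of "\<lambda>c. c * _"] cong: if_cong)

lemma affine_form_add:
  assumes "affine_form n f" "affine_form n g"
  shows "affine_form n (\<lambda>x. f x + g x)"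
proof -
  from assms obtain c b c' b' where "\<forall>x\<in>carrier_vec n. f x = (\<Sum>j<n. c j * x $ j) + b"
    "\<forall>x\<in>carrier_vec n. g x = (\<Sum>j<n. c' j * x $ j) + b'"
    unfolding affine_form_def by blast
  then show ?thesis unfolding affine_form_def
    by (intro exI[of _ "\<lambda>j. c j + c' j"] exI[of _ "b + b'"]) (simp add: distrib_right sum.distrib)
qed

lemma affine_form_scale:
  assumes "affine_form n f"
  shows "affine_form n (\<lambda>x. k * f x)"
proof -
  from assms obtain c b where "\<forall>x\<in>carrier_vec n. f x = (\<Sum>j<n. c j * x $ j) + b"
    unfolding affine_form_def by blast
  then show ?thesis unfolding affine_form_def
    by (intro exI[of _ "\<lambda>j. k * c j"] exI[of _ "k * b"]) (simp add: distrib_left sum_distrib_left mult.assoc)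
qed

lemma affine_form_sum:
  "(\<And>s. s \<in> S \<Longrightarrow> affine_form n (f s)) \<Longrightarrow> affine_form n (\<lambda>x. \<Sum>s\<in>S. f s x)"
  by (induction S rule: infinite_finite_induct) (auto intro: affine_form_const affine_form_add)

lemma affine_form_cong:
  "affine_form n f \<Longrightarrow> (\<And>x. x \<in> carrier_vec n \<Longrightarrow> f x = g x) \<Longrightarrow> affine_form n g"
  unfolding affine_form_def by metis

lemma affine_form_compose:
  assumes "affine_form n g" "\<And>i. i < n \<Longrightarrow> affine_form N (\<lambda>x. \<phi> x $ i)"
    and "\<And>x. x \<in> carrier_vec N \<Longrightarrow> \<phi> x \<in> carrier_vec n"
  shows "affine_form N (\<lambda>x. g (\<phi> x))"
proof -
  from assms(1) obtain c b where cb: "\<forall>x\<in>carrier_vec n. g x = (\<Sum>j<n. c j * x $ j) + b"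
    unfolding affine_form_def by blast
  have "affine_form N (\<lambda>x. (\<Sum>j<n. c j * \<phi> x $ j) + b)"
    using assms(2) by (intro affine_form_add affine_form_sum affine_form_scale affine_form_const) auto
  then show ?thesis by (rule affine_form_cong) (use cb assms(3) in auto)
qed

lemma polyfun_affine_form:
  assumes "affine_form n g"
  shows "polyfun n K 1 g"
proof -
  from assms obtain c b where cb: "\<forall>x\<in>carrier_vec n. g x = (\<Sum>j<n. c j * x $ j) + b"
    unfolding affine_form_def by blast
  have "polyfun n K 1 (\<lambda>x. (\<Sum>j<n. c j * x $ j) + b)"
    by (intro polyfun.add polyfun_sum polyfun_scale polyfun_coord polyfun.const) auto
  then show ?thesis by (rule polyfun.cong) (use cb in \<open>auto simp: cart_def\<close>)
qed

text \<open>Coordinate forms take the place of a matrix, which makes composition and extension by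
  one coordinate immediate; \<open>affine_map_matrix\<close> recovers the matrix when it is
  wanted.\<close>

definition affine_endo :: "nat \<Rightarrow> (nat \<Rightarrow> 'a::field set) \<Rightarrow> ('a vec \<Rightarrow> 'a vec) \<Rightarrow> bool" where
  "affine_endo n K \<phi> \<longleftrightarrow> (\<forall>i<n. affine_form n (\<lambda>x. \<phi> x $ i)) \<and>
    (\<forall>x\<in>carrier_vec n. \<phi> x \<in> carrier_vec n) \<and> (\<forall>x\<in>cart n K. \<phi> x \<in> cart n K)"

text \<open>The inverse is carried along as a map, so that automorphisms are composed and lifted in
  pairs. Both maps are inverse on all of \<open>carrier_vec n\<close>, from which
  \<open>affine_inverse_matrix\<close> obtains an invertible linear part.\<close>

definition affine_auto ::
    "nat \<Rightarrow> (nat \<Rightarrow> 'a::field set) \<Rightarrow> ('a vec \<Rightarrow> 'a vec) \<Rightarrow> ('a vec \<Rightarrow> 'a vec) \<Rightarrow> bool" where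
  "affine_auto n K \<phi> \<psi> \<longleftrightarrow> affine_endo n K \<phi> \<and> affine_endo n K \<psi> \<and>
    (\<forall>x\<in>carrier_vec n. \<psi> (\<phi> x) = x \<and> \<phi> (\<psi> x) = x)"

lemma affine_endo_comp:
  "affine_endo n K \<phi> \<Longrightarrow> affine_endo n K \<psi> \<Longrightarrow> affine_endo n K (\<lambda>x. \<phi> (\<psi> x))"
  unfolding affine_endo_def by (auto intro: affine_form_compose[of n "\<lambda>x. \<phi> x $ i" for i])

lemma affine_auto_comp:
  assumes "affine_auto n K \<phi> \<psi>" "affine_auto n K \<phi>' \<psi>'"
  shows "affine_auto n K (\<lambda>x. \<phi>' (\<phi> x)) (\<lambda>x. \<psi> (\<psi>' x))"
proof -
  have "affine_endo n K (\<lambda>x. \<phi>' (\<phi> x))" "affine_endo n K (\<lambda>x. \<psi> (\<psi>' x))"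
    using assms affine_endo_comp[of n K \<phi>' \<phi>] affine_endo_comp[of n K \<psi> \<psi>']
    by (simp_all add: affine_auto_def)
  moreover have "\<psi> (\<psi>' (\<phi>' (\<phi> x))) = x" "\<phi>' (\<phi> (\<psi> (\<psi>' x))) = x" if "x \<in> carrier_vec n" for x
    using that assms by (simp_all add: affine_auto_def affine_endo_def)
  ultimately show ?thesis by (simp add: affine_auto_def)
qed

lemma affine_auto_id: "affine_auto n K (\<lambda>x. x) (\<lambda>x. x)"
  by (auto simp: affine_auto_def affine_endo_def affine_form_coord)

lemma affine_auto_cart:
  assumes "affine_auto n K \<phi> \<psi>" "x \<in> cart n K"
  shows "\<phi> x \<in> cart n K" "\<psi> x \<in> cart n K" "\<psi> (\<phi> x) = x" "\<phi> (\<psi> x) = x"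
  using assms unfolding affine_auto_def affine_endo_def cart_def by auto

text \<open>Substituting forms of degree 1 for the variables cannot raise the total degree. This
  makes every coordinate of an automorphism as good as \<open>x $ 0\<close>.\<close>

lemma polyfun_affine_endo:
  assumes "polyfun n K d f" "affine_endo n K \<phi>"
  shows "polyfun n K d (\<lambda>x. f (\<phi> x))"
  using assms(1)
proof (induction rule: polyfun.induct)
  case (var i d f)
  then have "polyfun n K 1 (\<lambda>x. \<phi> x $ i)"
    using assms(2) by (intro polyfun_affine_form) (auto simp: affine_endo_def)
  from polyfun_mult[OF this var.IH] show ?case by simp
next
  case (cong d f g)
  show ?case by (rule polyfun.cong[OF cong.IH]) (use cong assms(2) in \<open>auto simp: affine_endo_def\<close>)
qed (auto intro: polyfun.intros)

lemma card_affine_auto: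
  assumes "affine_auto n K \<phi> \<psi>"
  shows "card {x \<in> cart n K. P (\<phi> x)} = card {x \<in> cart n K. P x}"
  by (rule bij_betw_same_card[of \<phi>], rule bij_betw_byWitness[where f'=\<psi>])
    (use affine_auto_cart[OF assms] in auto)

lemma weight_affine_auto:
  assumes "affine_auto n K \<phi> \<psi>"
  shows "weight n K (\<lambda>x. f (\<psi> x)) = weight n K f"
  unfolding weight_def using assms
  by (intro card_affine_auto[of n K \<psi> \<phi> "\<lambda>x. f x \<noteq> 0"]) (auto simp: affine_auto_def)

section \<open>Translations, lifts and shears that preserve the grid\<close>

definition subfield_chain :: "nat \<Rightarrow> (nat \<Rightarrow> 'a::field set) \<Rightarrow> bool" where
  "subfield_chain n K \<longleftrightarrow> (\<forall>i<n. is_subfield (K i)) \<and> (\<forall>i j. i \<le> j \<longrightarrow> j < n \<longrightarrow> K i \<subseteq> K j)"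

lemma subfield_chain_Suc: "subfield_chain (Suc n) K \<Longrightarrow> subfield_chain n (\<lambda>i. K (Suc i))"
  by (auto simp: subfield_chain_def)

lemma is_subfield_add: "is_subfield S \<Longrightarrow> a \<in> S \<Longrightarrow> b \<in> S \<Longrightarrow> a + b \<in> S"
  by (simp add: is_subfield_def)

lemma is_subfield_mult: "is_subfield S \<Longrightarrow> a \<in> S \<Longrightarrow> b \<in> S \<Longrightarrow> a * b \<in> S"
  by (simp add: is_subfield_def)

lemma is_subfield_diff: "is_subfield S \<Longrightarrow> a \<in> S \<Longrightarrow> b \<in> S \<Longrightarrow> a - b \<in> S"
  unfolding is_subfield_def by (metis add_uminus_conv_diff)

lemma affine_form_coord_add: "i < n \<Longrightarrow> affine_form n (\<lambda>x. x $ i + c)"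
  by (intro affine_form_add affine_form_coord affine_form_const)

lemma affine_form_coord_add_coord:
  "i < n \<Longrightarrow> j < n \<Longrightarrow> affine_form n (\<lambda>x. x $ i + c * x $ j)"
  by (intro affine_form_add affine_form_scale affine_form_coord)

lemma affine_auto_translation:
  assumes "subfield_chain n K" "p \<in> cart n K"
  shows "affine_auto n K (\<lambda>x. vec n (\<lambda>i. x $ i - p $ i)) (\<lambda>x. vec n (\<lambda>i. x $ i + p $ i))"
proof -
  have K: "is_subfield (K i)" "p $ i \<in> K i" if "i < n" for i
    using that assms by (auto simp: subfield_chain_def cart_def)
  have "affine_endo n K (\<lambda>x. vec n (\<lambda>i. x $ i - p $ i))"
    using affine_form_coord_add[of _ n "- p $ i" for i] K
    by (auto simp: affine_endo_def cart_def intro: is_subfield_diff)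
  moreover have "affine_endo n K (\<lambda>x. vec n (\<lambda>i. x $ i + p $ i))"
    using affine_form_coord_add K by (auto simp: affine_endo_def cart_def is_subfield_def)
  ultimately show ?thesis by (auto simp: affine_auto_def)
qed

definition vec_tl :: "'a vec \<Rightarrow> 'a vec" where
  "vec_tl x = vec (dim_vec x - 1) (\<lambda>i. x $ Suc i)"

lemma vec_tl_vCons [simp]: "vec_tl (vCons a y) = y"
  by (auto simp: vec_tl_def)

lemma carrier_vec_Suc_cases:
  assumes "x \<in> carrier_vec (Suc n)"
  obtains a y where "x = vCons a y" "y \<in> carrier_vec n"
  using assms by (cases x) auto

lemma affine_form_vec_tl:
  assumes "affine_form n g"
  shows "affine_form (Suc n) (\<lambda>x. g (vec_tl x))"
proof (rule affine_form_compose[OF assms])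
  fix i assume "i < n"
  then show "affine_form (Suc n) (\<lambda>x. vec_tl x $ i)"
    by (intro affine_form_cong[OF affine_form_coord[of "Suc i"]]) (auto simp: vec_tl_def)
qed (auto simp: vec_tl_def)

lemma affine_endo_lift:
  assumes "affine_endo n (\<lambda>i. K (Suc i)) \<phi>"
  shows "affine_endo (Suc n) K (\<lambda>x. vCons (x $ 0) (\<phi> (vec_tl x)))"
proof -
  have "affine_form (Suc n) (\<lambda>x. vCons (x $ 0) (\<phi> (vec_tl x)) $ i)" if "i < Suc n" for i
    using that assms by (cases i)
      (auto intro: affine_form_coord affine_form_vec_tl[of n "\<lambda>x. \<phi> x $ i" for i]
        simp: affine_endo_def vec_index_vCons)
  then show ?thesis using assms
    by (auto simp: affine_endo_def elim!: cart_Suc_cases carrier_vec_Suc_cases)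
qed

text \<open>Brings an automorphism found for the slices by induction back to the whole grid, with
  the first coordinate fixed.\<close>

lemma affine_auto_lift:
  assumes "affine_auto n (\<lambda>i. K (Suc i)) \<phi> \<psi>"
  shows "affine_auto (Suc n) K (\<lambda>x. vCons (x $ 0) (\<phi> (vec_tl x))) (\<lambda>x. vCons (x $ 0) (\<psi> (vec_tl x)))"
  using assms by (auto simp: affine_auto_def affine_endo_lift elim!: carrier_vec_Suc_cases)

text \<open>Turns the form x_1 + c x_0 into coordinate 0. The maps exchange the first two
  coordinates, so \<open>K 0 = K 1\<close> is what keeps them inside the grid.\<close>

lemma affine_auto_shear:
  assumes "subfield_chain n K" "1 < n" "K 0 = K 1" "c \<in> K 0"
  shows "affine_auto n K
    (\<lambda>x. vec n (\<lambda>i. if i = 0 then x $ 1 + c * x $ 0 else if i = 1 then x $ 0 else x $ i))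
    (\<lambda>x. vec n (\<lambda>i. if i = 0 then x $ 1 else if i = 1 then x $ 0 - c * x $ 1 else x $ i))"
proof -
  have K: "is_subfield (K 0)" using assms by (auto simp: subfield_chain_def)
  let ?f = "\<lambda>x. vec n (\<lambda>i. if i = 0 then x $ 1 + c * x $ 0 else if i = 1 then x $ 0 else x $ i)"
  let ?g = "\<lambda>x. vec n (\<lambda>i. if i = 0 then x $ 1 else if i = 1 then x $ 0 - c * x $ 1 else x $ i)"
  have "affine_form n (\<lambda>x. ?f x $ i)" if "i < n" for i
    using that assms(2) affine_form_coord_add_coord[of 1 n 0 c]
    by (cases "i = 0"; cases "i = 1") (simp_all add: affine_form_coord)
  moreover have "?f x \<in> cart n K" if "x \<in> cart n K" for x
  proof -
    have "x $ 1 + c * x $ 0 \<in> K 0"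
    proof (intro is_subfield_add[OF K] is_subfield_mult[OF K])
      show "x $ 1 \<in> K 0" using that assms(2,3) by (simp add: cart_def)
      show "x $ 0 \<in> K 0" using that assms(2) by (simp add: cart_def)
    qed fact
    then show ?thesis using that assms(2,3) by (auto simp: cart_def)
  qed
  ultimately have f: "affine_endo n K ?f" by (auto simp: affine_endo_def)
  have "affine_form n (\<lambda>x. ?g x $ i)" if "i < n" for i
    using that assms(2) affine_form_coord_add_coord[of 0 n 1 "- c"]
    by (cases "i = 0"; cases "i = 1") (simp_all add: affine_form_coord)
  moreover have "?g x \<in> cart n K" if "x \<in> cart n K" for x
  proof -
    have "x $ 0 - c * x $ 1 \<in> K 0"
    proof (intro is_subfield_diff[OF K] is_subfield_mult[OF K])
      show "x $ 1 \<in> K 0" using that assms(2,3) by (simp add: cart_def)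
      show "x $ 0 \<in> K 0" using that assms(2) by (simp add: cart_def)
    qed fact
    then show ?thesis using that assms(2,3) by (auto simp: cart_def)
  qed
  ultimately have "affine_endo n K ?g" by (auto simp: affine_endo_def)
  moreover have "?g (?f x) = x" "?f (?g x) = x" if "x \<in> carrier_vec n" for x
    using that assms(2) by (intro eq_vecI; simp)+
  ultimately show ?thesis using f by (simp only: affine_auto_def) blast
qed

subsection \<open>Minimal weight codewords\<close>

lemma support_in_hyperplane:
  fixes K :: "nat \<Rightarrow> 'a::{field, finite} set"
  assumes "subfield_chain n K" "0 < m" "m \<le> n" "polyfun n K (\<Sum>i<m. card (K i) - 1) f"
    and "x \<in> cart n K" "f x \<noteq> 0" "weight n K f \<le> (\<Prod>i\<in>{m..<n}. card (K i))"
  shows "\<exists>\<phi> \<psi>. affine_auto n K \<phi> \<psi> \<and> (\<forall>z\<in>cart n K. f z \<noteq> 0 \<longrightarrow> \<phi> z $ 0 = 0)"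
  using assms
proof (induction n arbitrary: K m f x)
  case 0
  then show ?case by simp
next
  case (Suc n)
  let ?K = "\<lambda>i. K (Suc i)"
  let ?goal = "\<exists>\<phi> \<psi>. affine_auto (Suc n) K \<phi> \<psi> \<and> (\<forall>z\<in>cart (Suc n) K. f z \<noteq> 0 \<longrightarrow> \<phi> z $ 0 = 0)"
  \<comment> \<open>It is enough to confine the support to some level set of a first coordinate; a
    translation by a grid point moves the level to 0.\<close>
  have translate: ?goal
    if "affine_auto (Suc n) K \<phi> \<psi>" "p \<in> cart (Suc n) K"
      "\<forall>z\<in>cart (Suc n) K. f z \<noteq> 0 \<longrightarrow> \<phi> z $ 0 = p $ 0" for \<phi> \<psi> p
    using affine_auto_comp[OF that(1) affine_auto_translation[OF Suc.prems(1) that(2)]] that(3)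
    by fastforce
  show ?case
  proof (cases "m = Suc n")
    \<comment> \<open>The weight bound is an empty product here, so \<open>x\<close> is the only
      point of the support.\<close>
    case True
    then have "card {z \<in> cart (Suc n) K. f z \<noteq> 0} \<le> Suc 0"
      using Suc.prems(7) by (simp add: weight_def)
    moreover have "finite {z \<in> cart (Suc n) K. f z \<noteq> 0}" using finite_cart[of "Suc n" K] by simp
    ultimately have "\<forall>z\<in>cart (Suc n) K. f z \<noteq> 0 \<longrightarrow> z = x"
      using Suc.prems(5,6) by (simp add: card_le_Suc0_iff_eq)
    then show ?thesis using translate[OF affine_auto_id Suc.prems(5)] by auto
  next
    case False
    then have m: "0 < m" "m < Suc n" using Suc.prems by auto
    have sub: "is_subfield (K i)" if "i < Suc n" for i
      using that Suc.prems(1) by (auto simp: subfield_chain_def)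
    have mono: "K i \<subseteq> K j" if "i \<le> j" "j < Suc n" for i j
      using that Suc.prems(1) by (auto simp: subfield_chain_def)
    have zero: "vCons a (0\<^sub>v n) \<in> cart (Suc n) K" if "a \<in> K 0" for a
      using that sub by (auto simp: is_subfield_def) (auto simp: cart_def is_subfield_def)
    define W where "W = (\<Prod>i\<in>{m<..<Suc n}. card (K i))"
    have "0 < W" unfolding W_def
    proof (intro prod_pos ballI)
      fix i assume "i \<in> {m<..<Suc n}"
      then have "0 \<in> K i" using sub by (simp add: is_subfield_def)
      then show "0 < card (K i)" by (auto simp: card_gt_0_iff)
    qed
    \<comment> \<open>\<open>slice_dichotomy\<close> is applied to \<open>f\<close> composed with
      \<open>\<psi>\<close>; its slices are the level sets of coordinate 0 of \<open>\<phi>\<close>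
      on the support of \<open>f\<close>.\<close>
    have dichotomy: "?goal \<or> (card (K 0) = card (K m) \<and>
        (\<forall>a\<in>K 0. card {z \<in> cart (Suc n) K. f z \<noteq> 0 \<and> \<phi> z $ 0 = a} = W))"
      if \<phi>: "affine_auto (Suc n) K \<phi> \<psi>" for \<phi> \<psi>
    proof -
      have f: "f (\<psi> (\<phi> x)) \<noteq> 0" "\<phi> x \<in> cart (Suc n) K"
        using affine_auto_cart[OF \<phi> Suc.prems(5)] Suc.prems(6) by auto
      have \<psi>: "affine_endo (Suc n) K \<psi>" using \<phi> by (simp add: affine_auto_def)
      from slice_dichotomy[OF _ _ m polyfun_affine_endo[OF Suc.prems(4) \<psi>] f(2,1)]
      have "(\<exists>a\<in>K 0. \<forall>z\<in>cart (Suc n) K. f (\<psi> z) \<noteq> 0 \<longrightarrow> z $ 0 = a) \<or>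
        (card (K 0) = card (K m) \<and> (\<forall>a\<in>K 0. weight n ?K (\<lambda>y. f (\<psi> (vCons a y))) = W))"
        using Suc.prems(7) mono by (simp add: weight_affine_auto[OF \<phi>] card_mono W_def)
      then show ?thesis
      proof
        assume "\<exists>a\<in>K 0. \<forall>z\<in>cart (Suc n) K. f (\<psi> z) \<noteq> 0 \<longrightarrow> z $ 0 = a"
        then obtain a where a: "a \<in> K 0"
          "\<And>z. z \<in> cart (Suc n) K \<Longrightarrow> f (\<psi> z) \<noteq> 0 \<Longrightarrow> z $ 0 = a" by blast
        have "\<phi> z $ 0 = a" if "z \<in> cart (Suc n) K" "f z \<noteq> 0" for z
          using a(2)[of "\<phi> z"] that affine_auto_cart[OF \<phi> that(1)] by simp
        then have ?goal using translate[OF \<phi> zero[OF a(1)]] by simp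
        then show ?thesis ..
      next
        assume R: "card (K 0) = card (K m) \<and> (\<forall>a\<in>K 0. weight n ?K (\<lambda>y. f (\<psi> (vCons a y))) = W)"
        have "card {z \<in> cart (Suc n) K. f z \<noteq> 0 \<and> \<phi> z $ 0 = a} = W" if a: "a \<in> K 0" for a
        proof -
          have "{z \<in> cart (Suc n) K. f z \<noteq> 0 \<and> \<phi> z $ 0 = a} =
              {z \<in> cart (Suc n) K. f (\<psi> (\<phi> z)) \<noteq> 0 \<and> \<phi> z $ 0 = a}"
            using affine_auto_cart(3)[OF \<phi>] by auto
          also have "card \<dots> = card {z \<in> cart (Suc n) K. f (\<psi> z) \<noteq> 0 \<and> z $ 0 = a}"
            by (rule card_affine_auto[OF \<phi>])
          also have "\<dots> = W" using R a by (simp add: weight_slice[of a K n "\<lambda>z. f (\<psi> z)", symmetric])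
          finally show ?thesis .
        qed
        with R show ?thesis by blast
      qed
    qed
    show ?thesis
    proof (rule ccontr)
      assume nothesis: "\<not> ?goal"
      have equi: "card {z \<in> cart (Suc n) K. f z \<noteq> 0 \<and> \<phi> z $ 0 = a} = W"
        if "affine_auto (Suc n) K \<phi> \<psi>" "a \<in> K 0" for \<phi> \<psi> a
        using dichotomy[OF that(1)] nothesis that(2) by blast
      have "card (K 0) = card (K m)" using dichotomy[OF affine_auto_id] nothesis by blast
      then have "K 0 = K m" using mono[of 0 m] m by (intro card_subset_eq) auto
      then have eq: "K i = K 0" if "i \<le> m" for i
        using that mono[of 0 i] mono[of i m] m by auto
      have K0: "0 \<in> K 0" "1 \<in> K 0" using sub by (auto simp: is_subfield_def)
      have slice: "weight n ?K (\<lambda>y. f (vCons a y)) = W" if "a \<in> K 0" for a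
        using equi[OF affine_auto_id that] weight_slice[of a K n f] that by simp
      have nonzero: "\<exists>y\<in>cart n ?K. f (vCons a y) \<noteq> 0" if "a \<in> K 0" for a
        using slice[OF that] \<open>0 < W\<close> by (auto simp: weight_def card_gt_0_iff)
      \<comment> \<open>Since \<open>K 0\<close> up to \<open>K m\<close> coincide, shifting the
        sides by one does not change the degree, and \<open>W\<close> is the extremal weight of the
        slice for the same \<open>m\<close>.\<close>
      have "(\<Sum>i<m. card (K i) - 1) = (\<Sum>i<m. card (?K i) - 1)"
      proof (rule sum.cong)
        fix i assume "i \<in> {..<m}"
        then show "card (K i) - 1 = card (K (Suc i)) - 1" using eq[of i] eq[of "Suc i"] by simp
      qed simp
      then have poly: "polyfun n ?K (\<Sum>i<m. card (?K i) - 1) (\<lambda>y. f (vCons 0 y))"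
        using polyfun_slice[OF Suc.prems(4) K0(1)] by simp
      have "W = (\<Prod>i\<in>{m..<n}. card (?K i))"
        unfolding W_def by (rule prod.reindex_bij_witness[of _ Suc "\<lambda>i. i - 1"]) auto
      then have weight: "weight n ?K (\<lambda>y. f (vCons 0 y)) \<le> (\<Prod>i\<in>{m..<n}. card (?K i))"
        using slice[OF K0(1)] by simp
      have "m \<le> n" using m by simp
      obtain y0 where y0: "y0 \<in> cart n ?K" "f (vCons 0 y0) \<noteq> 0" using nonzero[OF K0(1)] by blast
      obtain \<phi> \<psi> where \<phi>: "affine_auto n ?K \<phi> \<psi>"
        "\<forall>y\<in>cart n ?K. f (vCons 0 y) \<noteq> 0 \<longrightarrow> \<phi> y $ 0 = 0"
        using Suc.IH[OF subfield_chain_Suc[OF Suc.prems(1)] m(1) \<open>m \<le> n\<close> poly y0 weight]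
        by (elim exE conjE) (rule that)
      obtain y where y: "y \<in> cart n ?K" "f (vCons 1 y) \<noteq> 0" using nonzero[OF K0(2)] by blast
      define c where "c = - (\<phi> y $ 0)"
      have "\<phi> y $ 0 \<in> K 1"
        using affine_auto_cart(1)[OF \<phi>(1) y(1)] m by (auto simp: cart_def)
      then have c: "c \<in> K 0" using eq[of 1] m sub[of 0] by (auto simp: c_def is_subfield_def)
      text \<open>Among the hyperplanes through \<open>{x\<^sub>0 = 0, \<phi>\<^sub>0 = 0}\<close>, all of which contain the same number of
        points of the support, \<open>x\<^sub>0 = 0\<close> and \<open>\<phi>\<^sub>0 + c x\<^sub>0 = 0\<close> must meet the support in the same
        points. The value of \<open>c\<close> is chosen such that the second one contains a point with \<open>x\<^sub>0 = 1\<close>.\<close>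
      have "K 0 = K 1" "1 < Suc n" using eq[of 1] m by auto
      \<comment> \<open>Lifting puts coordinate 0 of \<open>\<phi>\<close> at index 1; the shear
        then adds \<open>c * x $ 0\<close> and moves it to index 0.\<close>
      then obtain \<Phi> \<Psi> where \<Phi>: "affine_auto (Suc n) K \<Phi> \<Psi>"
        and \<Phi>0: "\<And>x. \<Phi> x $ 0 = vCons (x $ 0) (\<phi> (vec_tl x)) $ 1 + c * x $ 0"
        using affine_auto_comp[OF affine_auto_lift[OF \<phi>(1)]
            affine_auto_shear[OF Suc.prems(1) _ _ c]] by fastforce
      have \<Phi>_vCons: "\<Phi> (vCons a z) $ 0 = \<phi> z $ 0 + c * a" if "z \<in> cart n ?K" for a z
        using affine_auto_cart(1)[OF \<phi>(1) that] m by (auto simp: \<Phi>0 vec_index_vCons)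
      let ?S = "{z \<in> cart (Suc n) K. f z \<noteq> 0 \<and> z $ 0 = 0}"
      let ?T = "{z \<in> cart (Suc n) K. f z \<noteq> 0 \<and> \<Phi> z $ 0 = 0}"
      have "?S \<subseteq> ?T" using \<phi>(2) by (auto simp: \<Phi>_vCons elim!: cart_Suc_cases)
      moreover have "card ?S = card ?T"
        using equi[OF affine_auto_id K0(1)] equi[OF \<Phi> K0(1)] by simp
      moreover have "finite ?T" using finite_cart[of "Suc n" K] by simp
      ultimately have "?S = ?T" by (intro card_subset_eq)
      moreover have "vCons 1 y \<in> ?T" using y K0 by (simp add: \<Phi>_vCons c_def)
      ultimately have "vCons 1 y \<in> ?S" by simp
      then show False by simp
    qed
  qed
qed

text \<open>Once the support lies in a hyperplane, the other \<open>card (K 0) - 1\<close> slices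
  are divided out. This uses exactly the degree share of the first side, so the remaining slice is
  extremal with \<open>m\<close> lowered by one. The recursion ends at \<open>m = 0\<close>, where
  degree 0 makes the function constant.\<close>

theorem minimal_weight_flat:
  fixes K :: "nat \<Rightarrow> 'a::{field, finite} set"
  assumes "subfield_chain n K" "m \<le> n" "polyfun n K (\<Sum>i<m. card (K i) - 1) f"
    and "x \<in> cart n K" "f x \<noteq> 0" "weight n K f \<le> (\<Prod>i\<in>{m..<n}. card (K i))"
  shows "\<exists>\<sigma> \<phi> \<psi>. \<sigma> \<noteq> 0 \<and> affine_auto n K \<phi> \<psi> \<and>
    (\<forall>z\<in>cart n K. f z = (if \<forall>i<m. \<phi> z $ i = 0 then \<sigma> else 0))"
  using assms
proof (induction n arbitrary: K m f x)
  case 0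
  then show ?case
    by (intro exI[of _ "f vNil"] exI[of _ "\<lambda>x. x"]) (auto simp: affine_auto_id)
next
  case (Suc n)
  let ?K = "\<lambda>i. K (Suc i)"
  show ?case
  proof (cases m)
    case 0
    then obtain c where "\<forall>z\<in>cart (Suc n) K. f z = c"
      using polyfun_degree_0[of "Suc n" K f] Suc.prems(3) by auto
    then show ?thesis using Suc.prems(4,5) 0
      by (intro exI[of _ c] exI[of _ "\<lambda>x. x"]) (auto simp: affine_auto_id)
  next
    case (Suc l)
    obtain \<phi> \<psi> where \<phi>: "affine_auto (Suc n) K \<phi> \<psi>"
      "\<forall>z\<in>cart (Suc n) K. f z \<noteq> 0 \<longrightarrow> \<phi> z $ 0 = 0"
      using support_in_hyperplane[of "Suc n" K m f x] Suc Suc.prems by auto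
    define g where "g z = f (\<psi> z)" for z
    have \<psi>: "affine_endo (Suc n) K \<psi>" using \<phi> by (simp add: affine_auto_def)
    have g0: "g (vCons a y) = 0" if "a \<in> K 0 - {0}" "y \<in> cart n ?K" for a y
    proof -
      have "vCons a y \<in> cart (Suc n) K" using that by simp
      from affine_auto_cart[OF \<phi>(1) this] show ?thesis
        using \<phi>(2) that by (force simp: g_def)
    qed
    have sub: "is_subfield (K 0)" using Suc.prems(1) by (auto simp: subfield_chain_def)
    then have K0: "0 \<in> K 0" by (simp add: is_subfield_def)
    have gx: "\<phi> x \<in> cart (Suc n) K" "g (\<phi> x) \<noteq> 0"
      using affine_auto_cart[OF \<phi>(1) Suc.prems(4)] Suc.prems(5) by (auto simp: g_def)
    have "polyfun (Suc n) K (\<Sum>i<m. card (K i) - 1) g"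
      unfolding g_def by (rule polyfun_affine_endo[OF Suc.prems(3) \<psi>])
    from polyfun_factor_roots[of "K 0 - {0}", OF _ _ this g0 gx]
    obtain h where h: "polyfun (Suc n) K ((\<Sum>i<m. card (K i) - 1) - card (K 0 - {0})) h"
      "\<forall>b\<in>K 0. \<forall>y\<in>cart n ?K. g (vCons b y) = (\<Prod>a\<in>K 0 - {0}. b - a) * h (vCons b y)"
      by auto
    have deg: "(\<Sum>i<m. card (K i) - 1) - card (K 0 - {0}) = (\<Sum>i<l. card (?K i) - 1)"
      using sum.lessThan_Suc_shift[of "\<lambda>i. card (K i) - 1" l] K0 by (simp add: Suc del: sum.lessThan_Suc)
    \<comment> \<open>Slicing \<open>g\<close> directly would keep the full degree. On x_0 = 0 the
      divided factors are constants, so \<open>g\<close> is a multiple of \<open>h\<close> there and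
      inherits its smaller degree.\<close>
    have "polyfun n ?K (\<Sum>i<l. card (?K i) - 1) (\<lambda>y. (\<Prod>a\<in>K 0 - {0}. 0 - a) * h (vCons 0 y))"
      using polyfun_slice[OF h(1) K0] unfolding deg by (rule polyfun_scale)
    then have "polyfun n ?K (\<Sum>i<l. card (?K i) - 1) (\<lambda>y. g (vCons 0 y))"
      by (rule polyfun.cong) (use h(2) K0 in auto)
    moreover obtain y where "y \<in> cart n ?K" "g (vCons 0 y) \<noteq> 0"
      using gx g0 by (metis Diff_iff cart_Suc_cases singletonD)
    moreover have "weight n ?K (\<lambda>y. g (vCons 0 y)) \<le> weight (Suc n) K g"
      unfolding weight_slice[of 0 K n g, OF K0] unfolding weight_def
      using finite_cart[of "Suc n" K] by (intro card_mono) auto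
    then have "weight n ?K (\<lambda>y. g (vCons 0 y)) \<le> (\<Prod>i\<in>{m..<Suc n}. card (K i))"
      using Suc.prems(6) weight_affine_auto[OF \<phi>(1), of f] unfolding g_def by linarith
    moreover have "(\<Prod>i\<in>{m..<Suc n}. card (K i)) = (\<Prod>i\<in>{l..<n}. card (?K i))"
      unfolding Suc by (rule prod.reindex_bij_witness[of _ Suc "\<lambda>i. i - 1"]) auto
    ultimately obtain \<sigma> \<phi>' \<psi>' where \<phi>': "\<sigma> \<noteq> 0" "affine_auto n ?K \<phi>' \<psi>'"
      "\<forall>z\<in>cart n ?K. g (vCons 0 z) = (if \<forall>i<l. \<phi>' z $ i = 0 then \<sigma> else 0)"
      using Suc.IH[OF subfield_chain_Suc[OF Suc.prems(1)], of l "\<lambda>y. g (vCons 0 y)" y]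
        Suc.prems(2) Suc by auto
    define \<Phi> where "\<Phi> z = vCons (\<phi> z $ 0) (\<phi>' (vec_tl (\<phi> z)))" for z
    have "f z = (if \<forall>i<m. \<Phi> z $ i = 0 then \<sigma> else 0)" if z: "z \<in> cart (Suc n) K" for z
    proof -
      obtain a y where ay: "\<phi> z = vCons a y" "a \<in> K 0" "y \<in> cart n ?K"
        using affine_auto_cart(1)[OF \<phi>(1) z] by (rule cart_Suc_cases)
      have "f z = g (vCons a y)" using affine_auto_cart(3)[OF \<phi>(1) z] ay by (simp add: g_def)
      moreover have "\<phi>' y \<in> carrier_vec n"
        using affine_auto_cart(1)[OF \<phi>'(2) ay(3)] by (simp add: cart_def)
      then have "(\<forall>i<m. \<Phi> z $ i = 0) \<longleftrightarrow> a = 0 \<and> (\<forall>i<l. \<phi>' y $ i = 0)"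
        by (auto simp: \<Phi>_def ay(1) Suc vec_index_vCons less_Suc_eq_0_disj)
      ultimately show ?thesis using g0[of a y] \<phi>'(3)[rule_format, OF ay(3)] ay(2,3)
        by (cases "a = 0") auto
    qed
    moreover have "affine_auto (Suc n) K \<Phi> (\<lambda>z. \<psi> (vCons (z $ 0) (\<psi>' (vec_tl z))))"
      unfolding \<Phi>_def by (rule affine_auto_comp[OF \<phi>(1) affine_auto_lift[OF \<phi>'(2)]])
    ultimately show ?thesis using \<phi>'(1) by blast
  qed
qed

subsection \<open>Reduced polynomials\<close>

lemma prod_indicator:
  "finite S \<Longrightarrow> (\<Prod>i\<in>S. if P i then 1 else (0 :: 'a::comm_semiring_1)) = (if \<forall>i\<in>S. P i then 1 else 0)"
  by (induction S rule: finite_induct) auto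

text \<open>Multiplication by \<open>x\<close> permutes the nonzero elements of \<open>S\<close>, so
  their product is unchanged when each is multiplied by \<open>x\<close>.\<close>

lemma is_subfield_power_card:
  fixes S :: "'a::{field, finite} set"
  assumes "is_subfield S" "x \<in> S" "x \<noteq> 0"
  shows "x ^ (card S - 1) = 1"
proof -
  have "bij_betw (\<lambda>y. x * y) (S - {0}) (S - {0})"
  proof (rule bij_betw_byWitness[where f' = "\<lambda>y. inverse x * y"])
    have "inverse x \<in> S" using assms by (simp add: is_subfield_def)
    then show "(\<lambda>y. inverse x * y) ` (S - {0}) \<subseteq> S - {0}"
      using assms is_subfield_mult[OF assms(1)] by auto
    show "(\<lambda>y. x * y) ` (S - {0}) \<subseteq> S - {0}"
      using assms is_subfield_mult[OF assms(1)] by auto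
  qed (use assms in auto)
  then have "(\<Prod>y\<in>S - {0}. x * y) = \<Prod>(S - {0})"
    by (rule prod.reindex_bij_betw[where g = "\<lambda>y. y"])
  moreover have "(\<Prod>y\<in>S - {0}. x * y) = x ^ (card S - 1) * \<Prod>(S - {0})"
    using assms(1) by (simp add: prod.distrib is_subfield_def)
  ultimately show ?thesis by simp
qed

lemma is_subfield_card_gt_1:
  fixes S :: "'a::{field, finite} set"
  assumes "is_subfield S"
  shows "1 < card S"
proof -
  have "card {0 :: 'a, 1} \<le> card S" using assms by (intro card_mono) (auto simp: is_subfield_def)
  then show ?thesis by simp
qed

lemma one_minus_power_card:
  fixes S :: "'a::{field, finite} set"
  assumes "is_subfield S" "x \<in> S"
  shows "1 - x ^ (card S - 1) = (if x = 0 then 1 else 0)"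
  using is_subfield_power_card[OF assms] is_subfield_card_gt_1[OF assms(1)] by (simp add: power_0_left)

lemma power_card_subfield:
  fixes S :: "'a::{field, finite} set"
  assumes "is_subfield S" "x \<in> S"
  shows "x ^ card S = x"
proof -
  obtain k where "card S = Suc k" "0 < k"
    using is_subfield_card_gt_1[OF assms(1)] by (cases "card S") auto
  then show ?thesis using is_subfield_power_card[OF assms] by (cases "x = 0") simp_all
qed

lemma mpoly_degree_le_iff:
  "mpoly_degree P \<le> d \<longleftrightarrow>
    (\<forall>m\<in>Poly_Mapping.keys P. (\<Sum>i\<in>Poly_Mapping.keys m. Poly_Mapping.lookup m i) \<le> d)"
  by (auto simp: mpoly_degree_def)

lemma mpoly_eval_superset:
  assumes "finite A" "Poly_Mapping.keys P \<subseteq> A"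
  shows "mpoly_eval P x = (\<Sum>m\<in>A. Poly_Mapping.lookup P m *
    (\<Prod>i\<in>Poly_Mapping.keys m. x $ i ^ Poly_Mapping.lookup m i))"
  unfolding mpoly_eval_def using assms
  by (intro sum.mono_neutral_left) (auto simp: in_keys_iff)

lemma mpoly_eval_add: "mpoly_eval (P + Q) x = mpoly_eval P x + mpoly_eval Q x"
proof -
  let ?A = "Poly_Mapping.keys P \<union> Poly_Mapping.keys Q"
  have "Poly_Mapping.keys (P + Q) \<subseteq> ?A" by (rule Poly_Mapping.keys_add)
  then show ?thesis
    by (simp add: mpoly_eval_superset[of ?A] lookup_add distrib_right sum.distrib)
qed

text \<open>Coincides with \<open>polyfun\<close> for subfields, by reducing exponents with \<open>x\<^sub>i ^ card (K i) = x\<^sub>i\<close>.\<close>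

definition reduced_fun :: "nat \<Rightarrow> (nat \<Rightarrow> 'a set) \<Rightarrow> nat \<Rightarrow> ('a vec \<Rightarrow> 'a::field) \<Rightarrow> bool" where
  "reduced_fun n K d f \<longleftrightarrow>
    (\<exists>P. is_reduced n K P \<and> mpoly_degree P \<le> d \<and> (\<forall>x\<in>cart n K. f x = mpoly_eval P x))"

lemma reduced_fun_add:
  assumes "reduced_fun n K d f" "reduced_fun n K d g"
  shows "reduced_fun n K d (\<lambda>x. f x + g x)"
proof -
  from assms obtain P Q where "is_reduced n K P" "mpoly_degree P \<le> d" "\<forall>x\<in>cart n K. f x = mpoly_eval P x"
    "is_reduced n K Q" "mpoly_degree Q \<le> d" "\<forall>x\<in>cart n K. g x = mpoly_eval Q x"
    unfolding reduced_fun_def by blast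
  moreover from this have "is_reduced n K (P + Q)" "mpoly_degree (P + Q) \<le> d"
    using Poly_Mapping.keys_add[of P Q] unfolding is_reduced_def mpoly_degree_le_iff by (meson UnE subsetD)+
  ultimately show ?thesis unfolding reduced_fun_def
    by (intro exI[of _ "P + Q"]) (simp add: mpoly_eval_add)
qed

lemma reduced_fun_sum:
  assumes "\<And>s. s \<in> S \<Longrightarrow> reduced_fun n K d (f s)"
  shows "reduced_fun n K d (\<lambda>x. \<Sum>s\<in>S. f s x)"
proof -
  have "reduced_fun n K d (\<lambda>x. 0)"
    unfolding reduced_fun_def
    by (intro exI[of _ 0]) (auto simp: is_reduced_def mpoly_degree_le_iff mpoly_eval_def)
  then show ?thesis using assms
    by (induction S rule: infinite_finite_induct) (auto intro: reduced_fun_add)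
qed

lemma reduced_fun_monomial:
  assumes "Poly_Mapping.keys m \<subseteq> {..<n}" "\<forall>i<n. Poly_Mapping.lookup m i < card (K i)"
    and "(\<Sum>i\<in>Poly_Mapping.keys m. Poly_Mapping.lookup m i) \<le> d"
    and "\<And>x. x \<in> cart n K \<Longrightarrow> f x = c * (\<Prod>i\<in>Poly_Mapping.keys m. x $ i ^ Poly_Mapping.lookup m i)"
  shows "reduced_fun n K d f"
proof -
  let ?P = "Poly_Mapping.single m c"
  have "Poly_Mapping.keys ?P \<subseteq> {m}" by simp
  moreover from this have "mpoly_eval ?P x = c * (\<Prod>i\<in>Poly_Mapping.keys m. x $ i ^ Poly_Mapping.lookup m i)" for x
    by (subst mpoly_eval_superset[of "{m}"]) auto
  ultimately show ?thesis using assms unfolding reduced_fun_def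
    by (intro exI[of _ ?P]) (auto simp: is_reduced_def mpoly_degree_le_iff split: if_splits)
qed

text \<open>Each monomial is multiplied separately. Either its exponent stays below
  \<open>card (K i)\<close>, or it reaches that value and is reduced, which only lowers the
  degree.\<close>

lemma reduced_fun_coord_mult:
  fixes K :: "nat \<Rightarrow> 'a::{field, finite} set"
  assumes "\<forall>i<n. is_subfield (K i)" "i < n" "reduced_fun n K d f"
  shows "reduced_fun n K (Suc d) (\<lambda>x. x $ i * f x)"
proof -
  obtain P where P: "is_reduced n K P" "mpoly_degree P \<le> d" "\<forall>x\<in>cart n K. f x = mpoly_eval P x"
    using assms(3) unfolding reduced_fun_def by blast
  have "reduced_fun n K (Suc d) (\<lambda>x. x $ i * (Poly_Mapping.lookup P m *
      (\<Prod>j\<in>Poly_Mapping.keys m. x $ j ^ Poly_Mapping.lookup m j)))"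
    if m: "m \<in> Poly_Mapping.keys P" for m
  proof -
    have red: "Poly_Mapping.keys m \<subseteq> {..<n}" "\<forall>j<n. Poly_Mapping.lookup m j < card (K j)"
      "(\<Sum>j\<in>Poly_Mapping.keys m. Poly_Mapping.lookup m j) \<le> d"
      using P m by (auto simp: is_reduced_def mpoly_degree_le_iff)
    \<comment> \<open>An exponent that reaches \<open>card (K i)\<close> drops to 1 and not to 0,
      because only x^q = x holds at 0 too.\<close>
    define e where "e = (if Suc (Poly_Mapping.lookup m i) < card (K i) then Suc (Poly_Mapping.lookup m i) else 1)"
    define m' where "m' = Poly_Mapping.update i e m"
    have e: "0 < e" "e < card (K i)" "e \<le> Suc (Poly_Mapping.lookup m i)"
      using is_subfield_card_gt_1[of "K i"] assms(1,2) by (auto simp: e_def)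
    have keys: "Poly_Mapping.keys m' = insert i (Poly_Mapping.keys m)"
      using e by (simp add: m'_def keys_update)
    have lookup: "Poly_Mapping.lookup m' j = (if j = i then e else Poly_Mapping.lookup m j)" for j
      by (simp add: m'_def lookup_update)
    let ?R = "Poly_Mapping.keys m - {i}"
    have sum: "(\<Sum>j\<in>Poly_Mapping.keys m. Poly_Mapping.lookup m j) =
        Poly_Mapping.lookup m i + (\<Sum>j\<in>?R. Poly_Mapping.lookup m j)"
      by (cases "i \<in> Poly_Mapping.keys m") (simp_all add: sum.remove in_keys_iff)
    have prod: "(\<Prod>j\<in>Poly_Mapping.keys m. x $ j ^ Poly_Mapping.lookup m j) =
        x $ i ^ Poly_Mapping.lookup m i * (\<Prod>j\<in>?R. x $ j ^ Poly_Mapping.lookup m j)" for x :: "'a vec"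
      by (cases "i \<in> Poly_Mapping.keys m") (simp_all add: prod.remove in_keys_iff)
    have sum': "(\<Sum>j\<in>Poly_Mapping.keys m'. Poly_Mapping.lookup m' j) =
        e + (\<Sum>j\<in>?R. Poly_Mapping.lookup m j)"
      unfolding keys by (simp add: sum.insert_remove lookup)
    have prod': "(\<Prod>j\<in>Poly_Mapping.keys m'. x $ j ^ Poly_Mapping.lookup m' j) =
        x $ i ^ e * (\<Prod>j\<in>?R. x $ j ^ Poly_Mapping.lookup m j)" for x :: "'a vec"
      unfolding keys by (simp add: prod.insert_remove lookup)
    have power: "x $ i * x $ i ^ Poly_Mapping.lookup m i = x $ i ^ e" if "x \<in> cart n K" for x
    proof (cases "Suc (Poly_Mapping.lookup m i) < card (K i)")
      case False
      then have "Suc (Poly_Mapping.lookup m i) = card (K i)" using red(2) assms(2) by (meson Suc_lessI)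
      moreover have "x $ i \<in> K i" using that assms(2) by (simp add: cart_def)
      ultimately show ?thesis using power_card_subfield[of "K i"] assms(1,2) False
        by (metis e_def power_Suc power_one_right)
    qed (simp add: e_def)
    show ?thesis
    proof (rule reduced_fun_monomial[of m' _ _ _ _ "Poly_Mapping.lookup P m"])
      show "Poly_Mapping.keys m' \<subseteq> {..<n}" using keys red(1) assms(2) by simp
      show "\<forall>j<n. Poly_Mapping.lookup m' j < card (K j)" using red(2) e(2) by (simp add: lookup)
      show "(\<Sum>j\<in>Poly_Mapping.keys m'. Poly_Mapping.lookup m' j) \<le> Suc d"
        using sum sum' red(3) e(3) by linarith
      show "x $ i * (Poly_Mapping.lookup P m *
          (\<Prod>j\<in>Poly_Mapping.keys m. x $ j ^ Poly_Mapping.lookup m j)) = Poly_Mapping.lookup P m *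
          (\<Prod>j\<in>Poly_Mapping.keys m'. x $ j ^ Poly_Mapping.lookup m' j)" if "x \<in> cart n K" for x
        unfolding prod prod' power[OF that, symmetric] by (simp add: mult_ac)
    qed
  qed
  then have "reduced_fun n K (Suc d) (\<lambda>x. \<Sum>m\<in>Poly_Mapping.keys P. x $ i * (Poly_Mapping.lookup P m *
      (\<Prod>j\<in>Poly_Mapping.keys m. x $ j ^ Poly_Mapping.lookup m j)))"
    by (rule reduced_fun_sum)
  then show ?thesis using P(3) by (simp add: reduced_fun_def mpoly_eval_def sum_distrib_left)
qed

lemma polyfun_imp_reduced_fun:
  fixes K :: "nat \<Rightarrow> 'a::{field, finite} set"
  assumes "\<forall>i<n. is_subfield (K i)" "polyfun n K d f"
  shows "reduced_fun n K d f"
  using assms(2)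
proof (induction rule: polyfun.induct)
  case (const d c)
  show ?case
  proof (rule reduced_fun_monomial[of 0 _ _ _ _ c])
    show "\<forall>i<n. Poly_Mapping.lookup 0 i < card (K i)"
      using is_subfield_card_gt_1 assms(1) by fastforce
  qed auto
next
  case (cong d f g)
  then show ?case by (simp add: reduced_fun_def)
qed (auto intro: reduced_fun_add reduced_fun_coord_mult[OF assms(1)])

lemma reduced_fun_imp_polyfun:
  assumes "reduced_fun n K d f"
  shows "polyfun n K d f"
proof -
  obtain P where P: "is_reduced n K P" "mpoly_degree P \<le> d" "\<forall>x\<in>cart n K. f x = mpoly_eval P x"
    using assms unfolding reduced_fun_def by blast
  have "polyfun n K d (\<lambda>x. \<Prod>i\<in>Poly_Mapping.keys m. x $ i ^ Poly_Mapping.lookup m i)"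
    if m: "m \<in> Poly_Mapping.keys P" for m
  proof (rule polyfun_mono)
    show "polyfun n K (\<Sum>i\<in>Poly_Mapping.keys m. Poly_Mapping.lookup m i * 1)
        (\<lambda>x. \<Prod>i\<in>Poly_Mapping.keys m. x $ i ^ Poly_Mapping.lookup m i)"
      using P(1) m by (intro polyfun_prod polyfun_power polyfun_coord) (auto simp: is_reduced_def)
    show "(\<Sum>i\<in>Poly_Mapping.keys m. Poly_Mapping.lookup m i * 1) \<le> d"
      using P(2) m by (simp add: mpoly_degree_le_iff)
  qed
  then have "polyfun n K d (\<lambda>x. mpoly_eval P x)"
    unfolding mpoly_eval_def by (intro polyfun_sum polyfun_scale)
  then show ?thesis by (rule polyfun.cong) (use P(3) in auto)
qed

section \<open>Interpolation and uniqueness of reduced polynomials\<close>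

lemma ex_polyfun:
  fixes K :: "nat \<Rightarrow> 'a::{field, finite} set"
  assumes "\<forall>i<n. is_subfield (K i)"
  shows "\<exists>d. polyfun n K d f"
proof -
  \<comment> \<open>Interpolation: the product of the factors 1 - (x_i - p_i)^(q_i - 1), with q_i =
    \<open>card (K i)\<close>, is the indicator of \<open>p\<close>. The shapes
    \<open>1 + (-1) * _\<close> and \<open>_ * 1\<close> are those produced by the closure rules of
    \<open>polyfun\<close>.\<close>
  define e where "e = (\<Sum>i<n. (card (K i) - 1) * 1)"
  have "polyfun n K e (\<lambda>x. \<Sum>p\<in>cart n K. f p * (\<Prod>i<n. 1 + (-1) * (x $ i + - p $ i) ^ (card (K i) - 1)))"
    unfolding e_def
    by (intro polyfun_sum polyfun_scale polyfun_prod polyfun.add polyfun_power polyfun_coord polyfun.const) auto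
  then have "polyfun n K e f"
  proof (rule polyfun.cong)
    fix x assume x: "x \<in> cart n K"
    have *: "(\<Prod>i<n. 1 + (-1) * (x $ i + - p $ i) ^ (card (K i) - 1)) = (if p = x then 1 else 0)"
      if p: "p \<in> cart n K" for p
    proof -
      have "x $ i - p $ i \<in> K i" if "i < n" for i
        using that x p assms by (intro is_subfield_diff) (auto simp: cart_def)
      then have factor: "1 + (-1) * (x $ i + - p $ i) ^ (card (K i) - 1) = (if x $ i = p $ i then 1 else 0)"
        if "i < n" for i
        using that assms one_minus_power_card[of "K i" "x $ i - p $ i"] by simp
      have "p = x \<longleftrightarrow> (\<forall>i<n. x $ i = p $ i)" using x p by (auto simp: cart_def)
      then show ?thesis using factor by (simp add: prod_indicator)
    qed
    then have "(\<Sum>p\<in>cart n K. f p * (\<Prod>i<n. 1 + (-1) * (x $ i + - p $ i) ^ (card (K i) - 1))) =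
        (\<Sum>p\<in>cart n K. if p = x then f p else 0)"
      by (intro sum.cong) auto
    also have "\<dots> = f x" using x finite_cart[of n K] by simp
    finally show "(\<Sum>p\<in>cart n K. f p * (\<Prod>i<n. 1 + (-1) * (x $ i + - p $ i) ^ (card (K i) - 1))) = f x" .
  qed
  then show ?thesis ..
qed

lemma card_cart:
  fixes K :: "nat \<Rightarrow> 'a::field set"
  assumes "\<forall>i<n. finite (K i)"
  shows "card (cart n K) = (\<Prod>i<n. card (K i))"
  using assms
proof (induction n arbitrary: K)
  case (Suc n)
  have w: "weight k L (\<lambda>x. 1 :: 'a) = card (cart k L)" for k L by (simp add: weight_def)
  have "card (cart (Suc n) K) = (\<Sum>a\<in>K 0. card (cart n (\<lambda>i. K (Suc i))))"
    using weight_Suc[OF Suc.prems, of "\<lambda>x. 1 :: 'a"] by (simp add: w)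
  also have "\<dots> = (\<Prod>i<Suc n. card (K i))"
    using Suc.IH[of "\<lambda>i. K (Suc i)"] Suc.prems by (simp add: prod.lessThan_Suc_shift del: prod.lessThan_Suc)
  finally show ?case .
qed simp

text \<open>There are as many functions on the grid as reduced polynomials, and every function is
  given by some reduced polynomial; hence evaluation is injective on reduced polynomials.\<close>

lemma reduced_unique:
  fixes K :: "nat \<Rightarrow> 'a::{field, finite} set"
  assumes "\<forall>i<n. is_subfield (K i)" "is_reduced n K P" "is_reduced n K Q"
    and "\<And>x. x \<in> cart n K \<Longrightarrow> mpoly_eval P x = mpoly_eval Q x"
  shows "P = Q"
proof -
  define M where "M = {m. Poly_Mapping.keys m \<subseteq> {..<n} \<and> (\<forall>i<n. Poly_Mapping.lookup m i < card (K i))}"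
  define A where "A = {P :: 'a mpoly. is_reduced n K P}"
  have A: "A = {P. Poly_Mapping.keys P \<subseteq> M}" by (auto simp: A_def M_def is_reduced_def)
  have injM: "inj_on (\<lambda>m. restrict (Poly_Mapping.lookup m) {..<n}) M"
  proof (rule inj_onI)
    fix m m' assume m: "m \<in> M" "m' \<in> M"
      "restrict (Poly_Mapping.lookup m) {..<n} = restrict (Poly_Mapping.lookup m') {..<n}"
    show "m = m'"
    proof (rule poly_mapping_eqI)
      fix i show "Poly_Mapping.lookup m i = Poly_Mapping.lookup m' i"
      proof (cases "i < n")
        case True
        then show ?thesis using fun_cong[OF m(3), of i] by simp
      next
        case False
        then have "i \<notin> Poly_Mapping.keys m" "i \<notin> Poly_Mapping.keys m'" using m by (auto simp: M_def)
        then show ?thesis by (simp add: in_keys_iff)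
      qed
    qed
  qed
  have imM: "(\<lambda>m. restrict (Poly_Mapping.lookup m) {..<n}) ` M \<subseteq> (\<Pi>\<^sub>E i\<in>{..<n}. {..<card (K i)})"
    by (intro image_subsetI) (simp add: M_def)
  have finM: "finite M" by (rule inj_on_finite[OF injM imM]) (simp add: finite_PiE)
  have cardM: "card M \<le> card (cart n K)"
    using card_inj_on_le[OF injM imM] by (simp add: finite_PiE card_PiE card_cart)
  have injA: "inj_on (\<lambda>P. restrict (Poly_Mapping.lookup P) M) A"
  proof (rule inj_onI)
    fix P Q assume P: "P \<in> A" "Q \<in> A"
      "restrict (Poly_Mapping.lookup P) M = restrict (Poly_Mapping.lookup Q) M"
    show "P = Q"
    proof (rule poly_mapping_eqI)
      fix m show "Poly_Mapping.lookup P m = Poly_Mapping.lookup Q m"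
      proof (cases "m \<in> M")
        case True
        then show ?thesis using fun_cong[OF P(3), of m] by simp
      next
        case False
        then have "m \<notin> Poly_Mapping.keys P" "m \<notin> Poly_Mapping.keys Q" using P by (auto simp: A)
        then show ?thesis by (simp add: in_keys_iff)
      qed
    qed
  qed
  have imA: "(\<lambda>P. restrict (Poly_Mapping.lookup P) M) ` A \<subseteq> M \<rightarrow>\<^sub>E UNIV" by auto
  have finA: "finite A" by (rule inj_on_finite[OF injA imA]) (simp add: finM finite_PiE)
  let ?E = "\<lambda>P. restrict (mpoly_eval P) (cart n K)"
  have fin: "finite (cart n K)" by (rule finite_cart) simp
  have "f \<in> ?E ` A" if f: "f \<in> fun_space n K" for f
  proof -
    obtain d where "polyfun n K d f" using ex_polyfun[OF assms(1)] by blast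
    from polyfun_imp_reduced_fun[OF assms(1) this]
    obtain P where "P \<in> A" "\<forall>x\<in>cart n K. f x = mpoly_eval P x" by (auto simp: reduced_fun_def A_def)
    moreover from this have "f = ?E P" using f by (auto simp: fun_space_def fun_eq_iff PiE_def extensional_def)
    ultimately show ?thesis by blast
  qed
  then have surj: "?E ` A = fun_space n K" by (auto simp: fun_space_def)
  \<comment> \<open>By \<open>surj\<close>, \<open>fun_space n K\<close> is the image of
    \<open>A\<close>, so its size is also at most \<open>card A\<close>. The chain closes up, and a
    map that preserves the size of a finite set is injective on it.\<close>
  have "card A \<le> card (UNIV :: 'a set) ^ card M"
    using card_inj_on_le[OF injA imA] finM by (simp add: finite_PiE card_PiE)
  also have "\<dots> \<le> card (UNIV :: 'a set) ^ card (cart n K)" using cardM by (intro power_increasing) (simp_all add: Suc_le_eq card_gt_0_iff)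
  also have "\<dots> = card (fun_space n K)" using fin by (simp add: fun_space_def card_PiE)
  finally have "card (?E ` A) = card A" using card_image_le[OF finA, of ?E] surj by simp
  then have "inj_on ?E A" by (rule eq_card_imp_inj_on[OF finA])
  moreover have "?E P = ?E Q" using assms(4) by (auto simp: fun_eq_iff)
  ultimately show ?thesis using assms(2,3) by (auto simp: inj_on_def A_def)
qed

section \<open>The code and its minimum distance in terms of polynomial functions\<close>

lemma fun_degree_le_iff:
  fixes K :: "nat \<Rightarrow> 'a::{field, finite} set"
  assumes "\<forall>i<n. is_subfield (K i)"
  shows "fun_degree n K f \<le> d \<longleftrightarrow> polyfun n K d f"
proof -
  \<comment> \<open>Uniqueness gives the definite description its meaning; a reduced polynomial to
    feed it comes from interpolation or from the given \<open>polyfun\<close> bound.\<close>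
  have spec: "reduced_poly n K f = P" if "is_reduced n K P" "\<forall>x\<in>cart n K. f x = mpoly_eval P x" for P
    unfolding reduced_poly_def using that reduced_unique[OF assms, where Q = P] by (intro the_equality) auto
  show ?thesis
  proof
    assume d: "fun_degree n K f \<le> d"
    obtain e where "polyfun n K e f" using ex_polyfun[OF assms] by blast
    from polyfun_imp_reduced_fun[OF assms this]
    obtain P where "is_reduced n K P" "\<forall>x\<in>cart n K. f x = mpoly_eval P x" by (auto simp: reduced_fun_def)
    with d spec show "polyfun n K d f"
      by (intro reduced_fun_imp_polyfun) (auto simp: reduced_fun_def fun_degree_def)
  next
    assume "polyfun n K d f"
    from polyfun_imp_reduced_fun[OF assms this]
    show "fun_degree n K f \<le> d" using spec by (auto simp: reduced_fun_def fun_degree_def)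
  qed
qed

text \<open>The witness \<open>g\<close> is the indicator of the flat on which the first
  \<open>m\<close> coordinates vanish. The resulting bound is the weight hypothesis that
  \<open>minimal_weight_flat\<close> asks for.\<close>

lemma min_dist_le:
  fixes K :: "nat \<Rightarrow> 'a::{field, finite} set"
  assumes "\<forall>i<n. is_subfield (K i)" "m \<le> n"
  shows "min_dist n K (\<Sum>i<m. card (K i) - 1) \<le> (\<Prod>i\<in>{m..<n}. card (K i))"
proof -
  let ?d = "\<Sum>i<m. card (K i) - 1"
  define g where "g = (\<lambda>x\<in>cart n K. \<Prod>i<m. 1 + (-1) * x $ i ^ (card (K i) - 1))"
  have g: "g x = (if \<forall>i<m. x $ i = 0 then 1 else 0)" if x: "x \<in> cart n K" for x
  proof -
    have "1 + (-1) * x $ i ^ (card (K i) - 1) = (if x $ i = 0 then 1 else 0)" if "i < m" for i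
      using that x assms one_minus_power_card[of "K i" "x $ i"] by (simp add: cart_def)
    then show ?thesis using x by (simp add: g_def prod_indicator)
  qed
  have "polyfun n K (\<Sum>i<m. (card (K i) - 1) * 1) (\<lambda>x. \<Prod>i<m. 1 + (-1) * x $ i ^ (card (K i) - 1))"
    using assms(2)
    by (intro polyfun_prod polyfun.add polyfun_scale polyfun_power polyfun_coord polyfun.const) auto
  then have "polyfun n K ?d g" unfolding mult_1_right by (rule polyfun.cong) (simp add: g_def)
  then have "g \<in> code n K ?d"
    using fun_degree_le_iff[OF assms(1)] by (auto simp: code_def fun_space_def g_def)
  moreover have "0\<^sub>v n \<in> cart n K" using assms(1) by (auto simp: cart_def is_subfield_def)
  then have "g (0\<^sub>v n) \<noteq> zero_fun n K (0\<^sub>v n)" using g assms(2) by (simp add: zero_fun_def)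
  then have "g \<noteq> zero_fun n K" by auto
  ultimately have "weight n K g \<in> weight n K ` (code n K ?d - {zero_fun n K})" by blast
  moreover have fin: "finite (cart n K)" by (rule finite_cart) simp
  then have "weight n K ` (code n K ?d - {zero_fun n K}) \<subseteq> {..card (cart n K)}"
    by (auto simp: weight_def intro!: card_mono)
  then have "finite (weight n K ` (code n K ?d - {zero_fun n K}))" by (rule finite_subset) simp
  ultimately have "min_dist n K ?d \<le> weight n K g" unfolding min_dist_def by (intro Min_le)
  \<comment> \<open>The support is again a grid, with sides \<open>{0}\<close> in the first
    \<open>m\<close> places, so \<open>card_cart\<close> counts it.\<close>
  also have "weight n K g = card (cart n (\<lambda>i. if i < m then {0} else K i))"
  proof -
    have L: "x \<in> cart n (\<lambda>i. if i < m then {0} else K i) \<longleftrightarrow> x \<in> cart n K \<and> (\<forall>i<m. x $ i = 0)" for x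
      using assms by (auto simp: cart_def is_subfield_def split: if_splits)
    have "{x \<in> cart n K. g x \<noteq> 0} = cart n (\<lambda>i. if i < m then {0} else K i)"
      by (auto simp: L g split: if_splits)
    then show ?thesis by (simp add: weight_def)
  qed
  also have "\<dots> = (\<Prod>i\<in>{m..<n}. card (K i))"
  proof -
    have "(\<Prod>i<n. card (if i < m then {0} else K i)) = (\<Prod>i\<in>{m..<n}. card (K i))"
      by (intro prod.mono_neutral_cong_right) auto
    then show ?thesis by (subst card_cart) auto
  qed
  finally show ?thesis .
qed

subsection \<open>Affine automorphisms as matrices\<close>

lemma affine_map_matrix:
  assumes "affine_endo n K \<phi>"
  obtains A \<beta> where "A \<in> carrier_mat n n" "\<beta> \<in> carrier_vec n"
    "\<And>x. x \<in> carrier_vec n \<Longrightarrow> \<phi> x = A *\<^sub>v x + \<beta>"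
proof -
  have "\<forall>i. \<exists>c b. i < n \<longrightarrow> (\<forall>x\<in>carrier_vec n. \<phi> x $ i = (\<Sum>j<n. c j * x $ j) + b)"
    using assms unfolding affine_endo_def affine_form_def by blast
  then obtain c b where cb: "\<And>i x. i < n \<Longrightarrow> x \<in> carrier_vec n \<Longrightarrow> \<phi> x $ i = (\<Sum>j<n. c i j * x $ j) + b i"
    by metis
  have "\<phi> x = mat n n (\<lambda>(i, j). c i j) *\<^sub>v x + vec n b" if "x \<in> carrier_vec n" for x
    using that assms cb
    by (intro eq_vecI) (auto simp: affine_endo_def scalar_prod_def atLeast0LessThan)
  then show thesis by (intro that[of "mat n n (\<lambda>(i, j). c i j)" "vec n b"]) auto
qed

text \<open>At the zero vector the identity \<open>inv\<close> says that the constant part of the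
  composite is zero. What remains is linear, and unit vectors read off the columns of
  \<open>A * B\<close>.\<close>

lemma affine_inverse_matrix:
  fixes A B :: "'a::field mat"
  assumes A: "A \<in> carrier_mat n n" and B: "B \<in> carrier_mat n n"
    and \<beta>: "\<beta> \<in> carrier_vec n" and \<gamma>: "\<gamma> \<in> carrier_vec n"
    and inv: "\<And>x. x \<in> carrier_vec n \<Longrightarrow> A *\<^sub>v (B *\<^sub>v x + \<gamma>) + \<beta> = x"
  shows "A * B = 1\<^sub>m n"
proof -
  have eq: "(A *\<^sub>v (B *\<^sub>v x)) $ i + ((A *\<^sub>v \<gamma>) $ i + \<beta> $ i) = x $ i"
    if x: "x \<in> carrier_vec n" and i: "i < n" for x i
  proof -
    have "A *\<^sub>v (B *\<^sub>v x + \<gamma>) = A *\<^sub>v (B *\<^sub>v x) + A *\<^sub>v \<gamma>"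
      using A B \<gamma> x by (intro mult_add_distrib_mat_vec) auto
    then have "(A *\<^sub>v (B *\<^sub>v x) + A *\<^sub>v \<gamma> + \<beta>) $ i = x $ i" using inv[OF x] by simp
    then show ?thesis using A B \<gamma> \<beta> x i by (simp add: add.assoc del: index_mult_mat_vec)
  qed
  have "A *\<^sub>v (B *\<^sub>v 0\<^sub>v n) = 0\<^sub>v n" using A B by (auto simp: scalar_prod_def)
  then have "(A *\<^sub>v \<gamma>) $ i + \<beta> $ i = 0" if "i < n" for i
    using eq[of "0\<^sub>v n" i] that by simp
  then have lin: "(A *\<^sub>v (B *\<^sub>v x)) $ i = x $ i" if "x \<in> carrier_vec n" "i < n" for x i
    using eq[OF that] that by simp
  show ?thesis
  proof (rule eq_matI)
    fix i j assume ij: "i < dim_row (1\<^sub>m n :: 'a mat)" "j < dim_col (1\<^sub>m n :: 'a mat)"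
    have "(A * B) $$ (i, j) = ((A * B) *\<^sub>v unit_vec n j) $ i"
      using ij A B by (simp del: assoc_mult_mat_vec)
    also have "\<dots> = (A *\<^sub>v (B *\<^sub>v unit_vec n j)) $ i"
      using A B by (subst assoc_mult_mat_vec) auto
    also have "\<dots> = unit_vec n j $ i" using ij by (intro lin) auto
    finally show "(A * B) $$ (i, j) = 1\<^sub>m n $$ (i, j)" using ij by (simp add: unit_vec_def)
  qed (use A B in auto)
qed

lemma affine_auto_imp_Aff_on:
  assumes "affine_auto n K \<phi> \<psi>"
  shows "restrict \<phi> (cart n K) \<in> Aff_on n K"
proof -
  have endo: "affine_endo n K \<phi>" "affine_endo n K \<psi>"
    using assms by (simp_all add: affine_auto_def)
  obtain A \<beta> where A: "A \<in> carrier_mat n n" "\<beta> \<in> carrier_vec n"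
    "\<And>x. x \<in> carrier_vec n \<Longrightarrow> \<phi> x = A *\<^sub>v x + \<beta>"
    by (rule affine_map_matrix[OF endo(1)]) (rule that)
  obtain B \<gamma> where B: "B \<in> carrier_mat n n" "\<gamma> \<in> carrier_vec n"
    "\<And>x. x \<in> carrier_vec n \<Longrightarrow> \<psi> x = B *\<^sub>v x + \<gamma>"
    by (rule affine_map_matrix[OF endo(2)]) (rule that)
  have inv: "\<psi> (\<phi> x) = x" "\<phi> (\<psi> x) = x" "\<phi> x \<in> carrier_vec n" "\<psi> x \<in> carrier_vec n"
    if "x \<in> carrier_vec n" for x
    using that assms by (auto simp: affine_auto_def affine_endo_def)
  have "A *\<^sub>v (B *\<^sub>v x + \<gamma>) + \<beta> = x" "B *\<^sub>v (A *\<^sub>v x + \<beta>) + \<gamma> = x" if "x \<in> carrier_vec n" for x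
    using inv[OF that] A(3) B(3) that by metis+
  then have "A * B = 1\<^sub>m n" "B * A = 1\<^sub>m n"
    using affine_inverse_matrix[OF A(1) B(1) A(2) B(2)] affine_inverse_matrix[OF B(1) A(1) B(2) A(2)]
    by blast+
  then have "invertible_mat A"
    using A(1) B(1) by (auto simp: invertible_mat_def inverts_mat_def)
  then have "(\<lambda>\<alpha>\<in>carrier_vec n. A *\<^sub>v \<alpha> + \<beta>) \<in> Aff n" using A by (auto simp: Aff_def)
  moreover have sub: "cart n K \<subseteq> carrier_vec n" by (auto simp: cart_def)
  then have eq: "restrict \<phi> (cart n K) = restrict (\<lambda>\<alpha>\<in>carrier_vec n. A *\<^sub>v \<alpha> + \<beta>) (cart n K)"
    using A(3) by (auto simp: fun_eq_iff)
  moreover have "(\<lambda>\<alpha>\<in>carrier_vec n. A *\<^sub>v \<alpha> + \<beta>) ` cart n K = cart n K"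
  proof -
    have "(\<lambda>\<alpha>\<in>carrier_vec n. A *\<^sub>v \<alpha> + \<beta>) ` cart n K = \<phi> ` cart n K"
      using A(3) sub by (intro image_cong) auto
    also have "\<dots> = cart n K"
    proof
      show "cart n K \<subseteq> \<phi> ` cart n K"
      proof
        fix x assume x: "x \<in> cart n K"
        show "x \<in> \<phi> ` cart n K"
          by (rule image_eqI[of _ _ "\<psi> x"]) (use affine_auto_cart[OF assms x] in auto)
      qed
    qed (use affine_auto_cart(1)[OF assms] in auto)
    finally show ?thesis .
  qed
  ultimately show ?thesis unfolding Aff_on_def by blast
qed

theorem proposition3p2:
  fixes K :: "nat \<Rightarrow> 'a::{field, finite} set"
    and n k d :: nat
    and f :: "'a vec \<Rightarrow> 'a"
  assumes "n \<ge> 1"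
    and "\<And>i. i < n \<Longrightarrow> is_subfield (K i)"
    and "\<And>i j. i \<le> j \<Longrightarrow> j < n \<Longrightarrow> K i \<subseteq> K j"
    and "k < n"
    and "d = (\<Sum>i<k+1. (card (K i) - 1))"
    and "f \<in> code n K d"
    and "f \<noteq> zero_fun n K"
    and "weight n K f = min_dist n K d"
  shows "\<exists>\<sigma>. \<sigma> \<noteq> 0 \<and>
    equivalent_on n K f (\<lambda>x \<in> cart n K. \<sigma> * (\<Prod>i<k+1. (1 - (x $ i) ^ (card (K i) - 1))))"
proof -
  have f: "f \<in> fun_space n K" "polyfun n K d f"
    using assms(6,7) fun_degree_le_iff[of n K] assms(2) by (auto simp: code_def)
  obtain x where x: "x \<in> cart n K" "f x \<noteq> 0"
    using f(1) assms(7) by (auto simp: fun_space_def zero_fun_def fun_eq_iff PiE_def extensional_def split: if_splits)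
  have "subfield_chain n K" using assms(2,3) by (auto simp: subfield_chain_def)
  moreover have "weight n K f \<le> (\<Prod>i\<in>{k+1..<n}. card (K i))"
    unfolding assms(5,8) using assms(2,4) by (intro min_dist_le) auto
  ultimately obtain \<sigma> \<phi> \<psi> where \<sigma>: "\<sigma> \<noteq> 0" "affine_auto n K \<phi> \<psi>"
    "\<forall>z\<in>cart n K. f z = (if \<forall>i<k+1. \<phi> z $ i = 0 then \<sigma> else 0)"
    using minimal_weight_flat[of n K "k+1" f x] f(2) x assms(4,5) by auto
  define g where "g = (\<lambda>x \<in> cart n K. \<sigma> * (\<Prod>i<k+1. (1 - (x $ i) ^ (card (K i) - 1))))"
  \<comment> \<open>Every factor is the indicator of a zero coordinate, so \<open>g\<close> is
    \<open>\<sigma>\<close> times the indicator of the coordinate flat whose pullback along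
    \<open>\<phi>\<close> is \<open>f\<close>.\<close>
  have g: "g z = (if \<forall>i<k+1. z $ i = 0 then \<sigma> else 0)" if z: "z \<in> cart n K" for z
  proof -
    have "1 - z $ i ^ (card (K i) - 1) = (if z $ i = 0 then 1 else 0)" if "i < k+1" for i
      using that z assms(4) by (intro one_minus_power_card assms(2)) (auto simp: cart_def)
    then have "(\<Prod>i<k+1. (1 - (z $ i) ^ (card (K i) - 1))) = (if \<forall>i<k+1. z $ i = 0 then 1 else 0)"
      by (simp add: prod_indicator del: prod.lessThan_Suc)
    then show ?thesis using z by (auto simp: g_def simp del: prod.lessThan_Suc)
  qed
  \<comment> \<open>Off the grid both sides take the default value of extensional functions.\<close>
  have "f = compose (cart n K) g (restrict \<phi> (cart n K))"
  proof
    fix z show "f z = compose (cart n K) g (restrict \<phi> (cart n K)) z"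
      using f(1) \<sigma>(3) g affine_auto_cart(1)[OF \<sigma>(2)]
      by (cases "z \<in> cart n K") (auto simp: compose_def fun_space_def PiE_def extensional_def)
  qed
  then have "equivalent_on n K f g"
    using affine_auto_imp_Aff_on[OF \<sigma>(2)] by (auto simp: equivalent_on_def)
  then show ?thesis using \<sigma>(1) unfolding g_def by blast
qed

end
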